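(* Let $\mathfrak{g}=\mathfrak{g}_{\bar 0}+\mathfrak{g}_{\bar 1}$ be a real Lie superalgebra with $\mathfrak{g}_{\bar 0}$ reductive, $\mathfrak{g}_{\bar 0}=\mathfrak{k}_0\oplus\mathfrak{k}_1\oplus\cdots\oplus\mathfrak{k}_s$ with $\mathfrak{k}_0$ Abelian and $\mathfrak{k}_1,\dots,\mathfrak{k}_s$ simple ideals. Let $\mathbf{B}$ be a bi-invariant metric on $\mathfrak{g}$ with $\mathbf{B}|_{\mathfrak{k}_i}=b_i\mathbf{K}_i$, $b_i\in\mathbb{R}$, for $1\le i\le s$, where $\mathbf{K}_i$ is the Killing form of $\mathfrak{k}_i$. Let $x_0,\dots,x_s\in\mathbb{R}\setminus\{0\}$, let $$\langle\cdot,\cdot\rangle=x_0\mathbf{B}|_{\mathfrak{k}_0}+x_1\mathbf{B}|_{\mathfrak{k}_1}+\cdots+x_s\mathbf{B}|_{\mathfrak{k}_s}+\mathbf{B}|_{\mathfrak{g}_{\bar 1}},$$ and let $c\in\mathbb{R}$. Let $\mathbf{K}$ be the Killing form of $\mathfrak{g}$, $l_i$ the index of the representation of $\mathfrak{k}_i$ on $\mathfrak{g}_{\bar 1}$, and $\mathcal{C}_{\mathbf{B}|_{\mathfrak{k}_i}}$ the Casimir operator of $\mathfrak{k}_i$ on $\mathfrak{g}_{\bar 1}$ with respect to $\mathbf{B}|_{\mathfrak{k}_i}$. Then $(\mathfrak{g},\langle\cdot,\cdot\rangle)$ is Einstein with $\mathrm{ric}=c\langle\cdot,\cdot\rangle$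 if and only if $$\left\{\begin{aligned}&-\frac{x_0}{4}\mathbf{K}|_{\mathfrak{k}_0}=c\,\mathbf{B}|_{\mathfrak{k}_0},\\ &\frac14(l_ix_i^2-1)=c\,x_ib_i,\quad 1\le i\le s,\\ &\sum_{i=0}^{s}\left(\frac{x_i}{2}-1\right)\mathcal{C}_{\mathbf{B}|_{\mathfrak{k}_i}}=c\,\mathrm{Id}|_{\mathfrak{g}_{\bar 1}}.\end{aligned}\right.$$
   Context: Lie superalgebras are finite dimensional with $\mathfrak{g}_{\bar 1}\ne 0$; $[X]\in\mathbb{Z}_2$ is the parity of a homogeneous element $X$, and formulas are written for homogeneous elements. A metric on $\mathfrak{g}$ is a non-degenerate bilinear form $f$ that is even ($f(\mathfrak{g}_{\bar 0},\mathfrak{g}_{\bar 1})=0$) and supersymmetric ($f(X,Y)=(-1)^{[X][Y]}f(Y,X)$). It is bi-invariant if $f([X,Y],Z)=f(X,[Y,Z])$. For a bi-invariant metric $\mathbf{B}$ the ideals $\mathfrak{k}_i$ are pairwise $\mathbf{B}$-orthogonal and each $\mathbf{B}|_{\mathfrak{k}_i}$ is non-degenerate. Killing form: $\mathbf{K}(X,Y)=\mathrm{str}(\mathrm{ad}X\circ\mathrm{ad}Y)$, where $\mathrm{str}$ is the supertrace (trace of the even-even block minus trace of the odd-odd block). Index: $l_i\in\mathbb{R}$ is the constant with $\mathrm{tr}(\mathrm{ad}X\circ\mathrm{ad}Y|_{\mathfrak{g}_{\bar 1}})=l_i\mathbf{K}_i(X,Y)$ for all $X,Y\in\mathfrak{k}_i$,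 $1\le i\le s$. Casimir operator: $\mathcal{C}_{\mathbf{B}|_{\mathfrak{k}_i}}=\sum_j(\mathrm{ad}\,e_j\circ\mathrm{ad}\,e_j^* )|_{\mathfrak{g}_{\bar 1}}$ for $0\le i\le s$, where $\{e_j\}$ is a basis of $\mathfrak{k}_i$ and $\{e_j^*\}\subset\mathfrak{k}_i$ is the dual basis, $\mathbf{B}(e_j,e_k^* )=\delta_{jk}$ (it is $0$ if $\mathfrak{k}_i=0$). The Levi-Civita connection $\nabla$ of a metric is the unique even bilinear map with $\langle\nabla_XY,Z\rangle+(-1)^{[X][Y]}\langle Y,\nabla_XZ\rangle=0$ and $\nabla_XY-(-1)^{[X][Y]}\nabla_YX=[X,Y]$. The curvature is $R(X,Y)Z=\nabla_X\nabla_YZ-(-1)^{[X][Y]}\nabla_Y\nabla_XZ-\nabla_{[X,Y]}Z$, and $\mathrm{ric}(X,Y)=\mathrm{str}(Z\mapsto R(Z,X)Y)$. *)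

theory Defs
  imports "HOL-Analysis.Analysis" "HOL-Library.Z2"
begin

section \<open>Direct sums, components, traces\<close>

definition direct_sum :: "'i set \<Rightarrow> ('i \<Rightarrow> 'a::real_vector set) \<Rightarrow> 'a set \<Rightarrow> bool" where
  "direct_sum I V W \<longleftrightarrow> finite I \<and> subspace W \<and> (\<forall>i\<in>I. subspace (V i) \<and> V i \<subseteq> W) \<and>
     (\<forall>x\<in>W. \<exists>!v. v \<in> Pi\<^sub>E I V \<and> sum v I = x)"

text \<open>The projection onto the \<open>i\<close>-th summand; meaningful on the sum of a direct family.\<close>

definition component :: "'i set \<Rightarrow> ('i \<Rightarrow> 'a::real_vector set) \<Rightarrow> 'i \<Rightarrow> 'a \<Rightarrow> 'a" where
  "component I V i x = (THE v. v \<in> Pi\<^sub>E I V \<and> sum v I = x) i"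

definition some_basis :: "'a::real_vector set \<Rightarrow> 'a set" where
  "some_basis V = (SOME E. independent E \<and> span E = V)"

text \<open>
  The trace of an endomorphism \<open>F\<close> of a finite dimensional subspace \<open>V\<close>; it does not depend on
  the chosen basis.  Only used for \<open>F\<close> mapping \<open>V\<close> into \<open>V\<close>.
\<close>

definition trace_on :: "'a::real_vector set \<Rightarrow> ('a \<Rightarrow> 'a) \<Rightarrow> real" where
  "trace_on V F = (\<Sum>e\<in>some_basis V. representation (some_basis V) (F e) e)"

section \<open>Lie superalgebras\<close>

text \<open>
  The superalgebra is the whole type \<open>'a\<close>, with grading \<open>g :: bit \<Rightarrow> 'a set\<close>: \<open>g 0\<close> is the even
  part, \<open>g 1\<close> the odd part, and parities are added in the two-element field.
\<close>

definition parity_sign :: "bit \<Rightarrow> bit \<Rightarrow> real" where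
  "parity_sign p q = (if p = 1 \<and> q = 1 then -1 else 1)"

locale lie_superalgebra =
  fixes g :: "bit \<Rightarrow> 'a::real_vector set" and br :: "'a \<Rightarrow> 'a \<Rightarrow> 'a"
  assumes finite_dimensional: "\<exists>S::'a set. finite S \<and> span S = UNIV"
    and grading: "direct_sum {0, 1} g UNIV"
    and odd_nonzero: "g 1 \<noteq> {0}"
    and bilinear_br: "bilinear br"
    and even_br: "\<And>p q X Y. X \<in> g p \<Longrightarrow> Y \<in> g q \<Longrightarrow> br X Y \<in> g (p + q)"
    and super_skew: "\<And>p q X Y. X \<in> g p \<Longrightarrow> Y \<in> g q \<Longrightarrow> br X Y = - (parity_sign p q *\<^sub>R br Y X)"
    and super_jacobi: "\<And>p q r X Y Z. X \<in> g p \<Longrightarrow> Y \<in> g q \<Longrightarrow> Z \<in> g r \<Longrightarrow>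
          br X (br Y Z) = br (br X Y) Z + parity_sign p q *\<^sub>R br Y (br X Z)"

text \<open>The homogeneous component of parity \<open>p\<close>.\<close>

abbreviation part :: "(bit \<Rightarrow> 'a::real_vector set) \<Rightarrow> bit \<Rightarrow> 'a \<Rightarrow> 'a" where
  "part g p \<equiv> component {0, 1} g p"

definition supertrace :: "(bit \<Rightarrow> 'a::real_vector set) \<Rightarrow> ('a \<Rightarrow> 'a) \<Rightarrow> real" where
  "supertrace g F = trace_on (g 0) (\<lambda>Z. part g 0 (F Z)) - trace_on (g 1) (\<lambda>Z. part g 1 (F Z))"

definition super_killing ::
  "(bit \<Rightarrow> 'a::real_vector set) \<Rightarrow> ('a \<Rightarrow> 'a \<Rightarrow> 'a) \<Rightarrow> 'a \<Rightarrow> 'a \<Rightarrow> real" where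
  "super_killing g br X Y = supertrace g (\<lambda>Z. br X (br Y Z))"

section \<open>The even part\<close>

definition is_ideal :: "('a::real_vector \<Rightarrow> 'a \<Rightarrow> 'a) \<Rightarrow> 'a set \<Rightarrow> 'a set \<Rightarrow> bool" where
  "is_ideal br L I \<longleftrightarrow> subspace I \<and> I \<subseteq> L \<and> (\<forall>X\<in>L. \<forall>Y\<in>I. br X Y \<in> I)"

definition is_abelian :: "('a::real_vector \<Rightarrow> 'a \<Rightarrow> 'a) \<Rightarrow> 'a set \<Rightarrow> bool" where
  "is_abelian br L \<longleftrightarrow> (\<forall>X\<in>L. \<forall>Y\<in>L. br X Y = 0)"

definition is_simple :: "('a::real_vector \<Rightarrow> 'a \<Rightarrow> 'a) \<Rightarrow> 'a set \<Rightarrow> bool" where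
  "is_simple br L \<longleftrightarrow> \<not> is_abelian br L \<and> (\<forall>I. is_ideal br L I \<longrightarrow> I = {0} \<or> I = L)"

text \<open>
  A Lie algebra \<open>L\<close> is reductive if and only if it has such a decomposition.  Both \<open>k 0 = {0}\<close> and
  \<open>s = 0\<close> are allowed.
\<close>

definition reductive_decomposition ::
  "('a::real_vector \<Rightarrow> 'a \<Rightarrow> 'a) \<Rightarrow> 'a set \<Rightarrow> nat \<Rightarrow> (nat \<Rightarrow> 'a set) \<Rightarrow> bool" where
  "reductive_decomposition br L s k \<longleftrightarrow>
     direct_sum {0..s} k L \<and> (\<forall>i\<in>{0..s}. is_ideal br L (k i)) \<and>
     is_abelian br (k 0) \<and> (\<forall>i\<in>{1..s}. is_simple br (k i))"

text \<open>The Killing form of a Lie subalgebra \<open>L\<close>, for arguments in \<open>L\<close>.\<close>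

definition killing :: "('a::real_vector \<Rightarrow> 'a \<Rightarrow> 'a) \<Rightarrow> 'a set \<Rightarrow> 'a \<Rightarrow> 'a \<Rightarrow> real" where
  "killing br L X Y = trace_on L (\<lambda>Z. br X (br Y Z))"

text \<open>
  \<open>l\<close> is the index of the representation of \<open>L\<close> on \<open>V\<close>: for simple \<open>L\<close> there is at most one such
  constant, since the Killing form is non-zero.
\<close>

definition is_index ::
  "('a::real_vector \<Rightarrow> 'a \<Rightarrow> 'a) \<Rightarrow> 'a set \<Rightarrow> 'a set \<Rightarrow> real \<Rightarrow> bool" where
  "is_index br L V l \<longleftrightarrow>
     (\<forall>X\<in>L. \<forall>Y\<in>L. trace_on V (\<lambda>Z. br X (br Y Z)) = l * killing br L X Y)"

definition dual_vector ::
  "('a::real_vector \<Rightarrow> 'a \<Rightarrow> real) \<Rightarrow> 'a set \<Rightarrow> 'a set \<Rightarrow> 'a \<Rightarrow> 'a" where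
  "dual_vector B L E e = (THE v. v \<in> L \<and> (\<forall>e'\<in>E. B e' v = (if e' = e then 1 else 0)))"

text \<open>
  Independent of the chosen basis of \<open>L\<close> when \<open>B\<close> is non-degenerate on \<open>L\<close>; zero for \<open>L = {0}\<close>.
\<close>

definition casimir ::
  "('a::real_vector \<Rightarrow> 'a \<Rightarrow> 'a) \<Rightarrow> ('a \<Rightarrow> 'a \<Rightarrow> real) \<Rightarrow> 'a set \<Rightarrow> 'a \<Rightarrow> 'a" where
  "casimir br B L Z = (\<Sum>e\<in>some_basis L. br e (br (dual_vector B L (some_basis L) e) Z))"

section \<open>Metrics and curvature\<close>

definition is_metric ::
  "(bit \<Rightarrow> 'a::real_vector set) \<Rightarrow> ('a \<Rightarrow> 'a \<Rightarrow> real) \<Rightarrow> bool" where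
  "is_metric g f \<longleftrightarrow> bilinear f \<and>
     (\<forall>X\<in>g 0. \<forall>Y\<in>g 1. f X Y = 0) \<and>
     (\<forall>p q. \<forall>X\<in>g p. \<forall>Y\<in>g q. f X Y = parity_sign p q * f Y X) \<and>
     (\<forall>X. (\<forall>Y. f X Y = 0) \<longrightarrow> X = 0)"

definition bi_invariant ::
  "('a::real_vector \<Rightarrow> 'a \<Rightarrow> 'a) \<Rightarrow> ('a \<Rightarrow> 'a \<Rightarrow> real) \<Rightarrow> bool" where
  "bi_invariant br f \<longleftrightarrow> (\<forall>X Y Z. f (br X Y) Z = f X (br Y Z))"

definition is_levi_civita ::
  "(bit \<Rightarrow> 'a::real_vector set) \<Rightarrow> ('a \<Rightarrow> 'a \<Rightarrow> 'a) \<Rightarrow> ('a \<Rightarrow> 'a \<Rightarrow> real) \<Rightarrow> ('a \<Rightarrow> 'a \<Rightarrow> 'a) \<Rightarrow> bool"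
where
  "is_levi_civita g br f D \<longleftrightarrow> bilinear D \<and>
     (\<forall>p q. \<forall>X\<in>g p. \<forall>Y\<in>g q. D X Y \<in> g (p + q)) \<and>
     (\<forall>p q r. \<forall>X\<in>g p. \<forall>Y\<in>g q. \<forall>Z\<in>g r.
        f (D X Y) Z + parity_sign p q * f Y (D X Z) = 0) \<and>
     (\<forall>p q. \<forall>X\<in>g p. \<forall>Y\<in>g q. D X Y - parity_sign p q *\<^sub>R D Y X = br X Y)"

definition levi_civita ::
  "(bit \<Rightarrow> 'a::real_vector set) \<Rightarrow> ('a \<Rightarrow> 'a \<Rightarrow> 'a) \<Rightarrow> ('a \<Rightarrow> 'a \<Rightarrow> real) \<Rightarrow> 'a \<Rightarrow> 'a \<Rightarrow> 'a" where
  "levi_civita g br f = (THE D. is_levi_civita g br f D)"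

text \<open>
  The curvature formula involves the parities of \<open>X\<close> and \<open>Y\<close>; it is extended bilinearly to
  inhomogeneous arguments through their homogeneous components.
\<close>

definition curvature ::
  "(bit \<Rightarrow> 'a::real_vector set) \<Rightarrow> ('a \<Rightarrow> 'a \<Rightarrow> 'a) \<Rightarrow> ('a \<Rightarrow> 'a \<Rightarrow> real) \<Rightarrow> 'a \<Rightarrow> 'a \<Rightarrow> 'a \<Rightarrow> 'a"
where
  "curvature g br f X Y Z = (let D = levi_civita g br f in
     (\<Sum>p\<in>{0, 1}. \<Sum>q\<in>{0, 1}.
        D (part g p X) (D (part g q Y) Z)
        - parity_sign p q *\<^sub>R D (part g q Y) (D (part g p X) Z)
        - D (br (part g p X) (part g q Y)) Z))"

definition ricci ::
  "(bit \<Rightarrow> 'a::real_vector set) \<Rightarrow> ('a \<Rightarrow> 'a \<Rightarrow> 'a) \<Rightarrow> ('a \<Rightarrow> 'a \<Rightarrow> real) \<Rightarrow> 'a \<Rightarrow> 'a \<Rightarrow> real" where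
  "ricci g br f X Y = supertrace g (\<lambda>Z. curvature g br f Z X Y)"

definition einstein_with ::
  "(bit \<Rightarrow> 'a::real_vector set) \<Rightarrow> ('a \<Rightarrow> 'a \<Rightarrow> 'a) \<Rightarrow> ('a \<Rightarrow> 'a \<Rightarrow> real) \<Rightarrow> real \<Rightarrow> bool" where
  "einstein_with g br f c \<longleftrightarrow> (\<forall>X Y. ricci g br f X Y = c * f X Y)"

text \<open>
  The form \<open>x\<^sub>0 B|k\<^sub>0 + \<dots> + x\<^sub>s B|k\<^sub>s + B|g\<^sub>1\<close>, each restriction being extended by zero to the other
  summands of \<open>k\<^sub>0 \<oplus> \<dots> \<oplus> k\<^sub>s \<oplus> g\<^sub>1\<close>.
\<close>

definition scaled_metric ::
  "(bit \<Rightarrow> 'a::real_vector set) \<Rightarrow> nat \<Rightarrow> (nat \<Rightarrow> 'a set) \<Rightarrow> ('a \<Rightarrow> 'a \<Rightarrow> real) \<Rightarrow>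
    (nat \<Rightarrow> real) \<Rightarrow> 'a \<Rightarrow> 'a \<Rightarrow> real" where
  "scaled_metric g s k B x X Y =
     (\<Sum>i\<in>{0..s}. x i * B (component {0..s} k i (part g 0 X)) (component {0..s} k i (part g 0 Y)))
     + B (part g 1 X) (part g 1 Y)"

end

theory Submission
  imports Defs
begin

text \<open>
  Write the metric as \<open>B (A X) Y\<close>, where \<open>A\<close> is \<open>x i\<close> on \<open>k i\<close> and the identity on \<open>g 1\<close>.  Its
  Levi-Civita connection is \<open>2 \<nabla>\<^sub>X Y = [X, Y] + [X, A Y] - [A X, Y]\<close>, so every curvature is a
  combination of iterated brackets.  Evaluating the supertraces in \<open>B\<close>-dual bases gives
  \<open>ric(X, Y) = - K\<^sub>i(X, Y) / 4 + (x i)\<^sup>2 / 4 tr(ad X ad Y | g 1)\<close> on \<open>k i\<close>, while the traces on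
  \<open>g 1 \<times> g 1\<close> all contract to Casimir operators: \<open>ric(X, Y) = B(X, \<Sum>\<^sub>i (x i / 2 - 1) C\<^sub>i Y)\<close>.
  All mixed values vanish, those on \<open>k i \<times> k j\<close> because at least one of the two ideals is
  perfect.  The equivalence follows as \<open>B\<close> is non-degenerate and, since
  \<open>B = b i K\<^sub>i\<close> on \<open>k i\<close>, the Killing form of a simple \<open>k i\<close> is non-zero.
\<close>

text \<open>Signs are the main difficulty. \<open>B\<close> is symmetric on \<open>g 0\<close> but
  symplectic on \<open>g 1\<close>, so exchanging the two members of a dual pair is free on each
  \<open>k i\<close> and costs a sign on \<open>g 1\<close>; the supertrace subtracts the odd block
  on top of that. \<open>A\<close> does not respect arbitrary brackets: the bracket of two odd
  vectors spreads over all the \<open>k i\<close>, where the weights differ. This is why the odd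
  Ricci values need the expansion in dual bases. What \<open>A\<close> does commute with is the
  bracket by an even vector, since that bracket preserves every \<open>k i\<close> and
  \<open>g 1\<close>. The vector \<open>X - A X\<close> is always even, which is enough for the
  connection to be metric. The first equation contains the Killing form of the superalgebra because
  \<open>k 0\<close> acts trivially on \<open>g 0\<close>: there \<open>super_killing\<close> is
  minus the trace on \<open>g 1\<close>, the only trace left in the Ricci curvature of
  \<open>k 0\<close>.\<close>

lemma bilinear_comp_linear:
  assumes "bilinear h" "linear F" "linear G"
  shows "bilinear (\<lambda>x y. h (F x) (G y))"
  using assms by (auto simp: bilinear_def linear_iff)

lemma bilinear_sum_left: "bilinear h \<Longrightarrow> h (sum F I) y = (\<Sum>i\<in>I. h (F i) y)"
  using linear_sum[of "\<lambda>x. h x y"] by (simp add: bilinear_def)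

lemma bilinear_sum_right: "bilinear h \<Longrightarrow> h x (sum F I) = (\<Sum>i\<in>I. h x (F i))"
  using linear_sum[of "h x"] by (simp add: bilinear_def)

lemmas bilinear_simps =
  bilinear_ladd bilinear_radd bilinear_lsub bilinear_rsub bilinear_lmul bilinear_rmul
  bilinear_lneg bilinear_rneg bilinear_lzero bilinear_rzero

section \<open>Direct sums\<close>

lemma direct_sum_component:
  assumes "direct_sum I V W" "x \<in> W"
  shows "i \<in> I \<Longrightarrow> component I V i x \<in> V i"
    and "(\<Sum>i\<in>I. component I V i x) = x"
proof -
  have "\<exists>!v. v \<in> Pi\<^sub>E I V \<and> sum v I = x"
    using assms by (auto simp: direct_sum_def)
  from theI'[OF this] show "i \<in> I \<Longrightarrow> component I V i x \<in> V i"
    and "(\<Sum>i\<in>I. component I V i x) = x"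
    by (auto simp: component_def)
qed

lemma component_eqI:
  assumes "direct_sum I V W" "\<And>j. j \<in> I \<Longrightarrow> v j \<in> V j" "sum v I = x" "i \<in> I"
  shows "component I V i x = v i"
proof -
  have "x \<in> W"
    using assms by (auto simp: direct_sum_def intro!: subspace_sum)
  then have ex: "\<exists>!w. w \<in> Pi\<^sub>E I V \<and> sum w I = x"
    using assms(1) by (auto simp: direct_sum_def)
  have "restrict v I \<in> Pi\<^sub>E I V \<and> sum (restrict v I) I = x"
    using assms by auto
  then have "(THE w. w \<in> Pi\<^sub>E I V \<and> sum w I = x) = restrict v I"
    using ex by (intro the1_equality)
  then show ?thesis
    using assms(4) by (simp add: component_def)
qed

lemma component_add:
  assumes "direct_sum I V W" "x \<in> W" "y \<in> W" "i \<in> I"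
  shows "component I V i (x + y) = component I V i x + component I V i y"
proof (rule component_eqI[OF assms(1) _ _ assms(4)])
  show "component I V j x + component I V j y \<in> V j" if "j \<in> I" for j
    using that assms direct_sum_component(1)[OF assms(1)]
    by (auto simp: direct_sum_def intro!: subspace_add)
  show "(\<Sum>i\<in>I. component I V i x + component I V i y) = x + y"
    using assms by (simp add: sum.distrib direct_sum_component(2))
qed

lemma component_scale:
  assumes "direct_sum I V W" "x \<in> W" "i \<in> I"
  shows "component I V i (r *\<^sub>R x) = r *\<^sub>R component I V i x"
proof (rule component_eqI[OF assms(1) _ _ assms(3)])
  show "r *\<^sub>R component I V j x \<in> V j" if "j \<in> I" for j
    using that assms direct_sum_component(1)[OF assms(1)]
    by (auto simp: direct_sum_def intro!: subspace_scale)
  show "(\<Sum>i\<in>I. r *\<^sub>R component I V i x) = r *\<^sub>R x"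
    using assms by (simp add: direct_sum_component(2) flip: scaleR_sum_right)
qed

lemma component_summand:
  assumes "direct_sum I V W" "j \<in> I" "x \<in> V j" "i \<in> I"
  shows "component I V i x = (if i = j then x else 0)"
proof -
  have "finite I"
    using assms(1) by (simp add: direct_sum_def)
  then show ?thesis
    using assms
    by (intro component_eqI[OF assms(1), where v = "\<lambda>i. if i = j then x else 0"])
      (auto simp: direct_sum_def subspace_0)
qed

section \<open>Bases, traces and dual families\<close>

lemma some_basis:
  assumes "subspace V"
  shows "independent (some_basis V)" "span (some_basis V) = V"
proof -
  obtain E where "E \<subseteq> V" "independent E" "V \<subseteq> span E"
    using maximal_independent_subset[of V] by metis
  then have "independent E \<and> span E = V"
    using span_minimal[OF _ assms, of E] by auto
  then have "independent (some_basis V) \<and> span (some_basis V) = V"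
    unfolding some_basis_def by (rule someI)
  then show "independent (some_basis V)" "span (some_basis V) = V"
    by auto
qed

lemma finite_some_basis:
  assumes "\<exists>S::'a::real_vector set. finite S \<and> span S = UNIV" "subspace V"
  shows "finite (some_basis (V :: 'a set))"
  using assms independent_span_bound some_basis[OF assms(2)] by (metis subset_UNIV)

lemma sum_representation_some_basis:
  assumes "\<exists>S::'a::real_vector set. finite S \<and> span S = UNIV" "subspace V" "v \<in> V"
  shows "(\<Sum>e\<in>some_basis V. representation (some_basis V) v e *\<^sub>R e) = (v :: 'a)"
  using assms some_basis[OF assms(2)] finite_some_basis[OF assms(1,2)]
  by (intro sum_representation_eq) auto

lemma some_basis_subset: "subspace V \<Longrightarrow> some_basis V \<subseteq> V"
  using some_basis(2) span_superset by metis

lemma trace_on_cong: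
  assumes "subspace V" "\<And>Z. Z \<in> V \<Longrightarrow> F Z = G Z"
  shows "trace_on V F = trace_on V G"
  unfolding trace_on_def
  using some_basis_subset[OF assms(1)] assms(2) by (intro sum.cong) auto

lemma trace_on_zero: "trace_on V (\<lambda>Z. 0) = 0"
  unfolding trace_on_def by (simp add: representation_zero)

lemma trace_on_diff:
  assumes "subspace V" "\<And>Z. Z \<in> V \<Longrightarrow> F Z \<in> V" "\<And>Z. Z \<in> V \<Longrightarrow> G Z \<in> V"
  shows "trace_on V (\<lambda>Z. F Z - G Z) = trace_on V F - trace_on V G"
proof -
  have "representation (some_basis V) (F e - G e) e =
      representation (some_basis V) (F e) e - representation (some_basis V) (G e) e"
    if "e \<in> some_basis V" for e
    using that assms some_basis_subset[of V]
    by (subst representation_diff) (auto simp: some_basis)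
  then show ?thesis
    unfolding trace_on_def by (simp add: sum_subtractf)
qed

text \<open>Dual bases are encoded by the expansion formula, the form in which trace computations
  use them. The index type is free so that bases of several ideals can be joined, and the order of
  the arguments of \<open>B\<close> matters because \<open>B\<close> is skew on
  \<open>g 1\<close>.\<close>

definition dual_families ::
  "('a::real_vector \<Rightarrow> 'a \<Rightarrow> real) \<Rightarrow> 'a set \<Rightarrow> 'i set \<Rightarrow> ('i \<Rightarrow> 'a) \<Rightarrow> ('i \<Rightarrow> 'a) \<Rightarrow> bool"
where
  "dual_families B V I e f \<longleftrightarrow> finite I \<and> (\<forall>a\<in>I. e a \<in> V \<and> f a \<in> V) \<and>
     (\<forall>v\<in>V. (\<Sum>a\<in>I. B v (f a) *\<^sub>R e a) = v)"

text \<open>Expanding each basis vector \<open>u\<close> before applying \<open>F\<close> produces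
  the coordinates of \<open>F (e a)\<close>; summing over \<open>u\<close> reassembles
  \<open>F (e a)\<close> inside \<open>B\<close>.\<close>

lemma trace_on_dual_families:
  assumes fd: "\<exists>S::'a::real_vector set. finite S \<and> span S = UNIV"
    and V: "subspace (V :: 'a set)" and B: "bilinear B"
    and d: "dual_families B V I e f"
    and F: "linear F" "\<And>Z. Z \<in> V \<Longrightarrow> F Z \<in> V"
  shows "trace_on V F = (\<Sum>a\<in>I. B (F (e a)) (f (a :: 'i)))"
proof -
  let ?E = "some_basis V"
  let ?r = "representation ?E"
  note E = some_basis[OF V]
  have "?r (F u) u = (\<Sum>a\<in>I. B u (f a) * ?r (F (e a)) u)" if "u \<in> ?E" for u
  proof -
    have u: "u \<in> V"
      using that some_basis_subset[OF V] by auto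
    have "F u = F (\<Sum>a\<in>I. B u (f a) *\<^sub>R e a)"
      using d u by (simp add: dual_families_def)
    also have "\<dots> = (\<Sum>a\<in>I. B u (f a) *\<^sub>R F (e a))"
      using F by (simp add: linear_sum linear_cmul)
    finally have "?r (F u) = ?r (\<Sum>a\<in>I. B u (f a) *\<^sub>R F (e a))"
      by simp
    also have "\<dots> = (\<lambda>b. \<Sum>a\<in>I. ?r (B u (f a) *\<^sub>R F (e a)) b)"
      using d F E by (intro representation_sum) (auto simp: dual_families_def V subspace_scale)
    also have "\<dots> = (\<lambda>b. \<Sum>a\<in>I. B u (f a) * ?r (F (e a)) b)"
      using d F E by (intro ext sum.cong refl, subst representation_scale)
        (auto simp: dual_families_def)
    finally show ?thesis
      by simp
  qed
  then have "trace_on V F = (\<Sum>u\<in>?E. \<Sum>a\<in>I. B u (f a) * ?r (F (e a)) u)"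
    unfolding trace_on_def by simp
  also have "\<dots> = (\<Sum>a\<in>I. \<Sum>u\<in>?E. B u (f a) * ?r (F (e a)) u)"
    by (rule sum.swap)
  also have "\<dots> = (\<Sum>a\<in>I. B (\<Sum>u\<in>?E. ?r (F (e a)) u *\<^sub>R u) (f a))"
    by (simp add: bilinear_sum_left[OF B] bilinear_lmul[OF B] mult.commute)
  also have "\<dots> = (\<Sum>a\<in>I. B (F (e a)) (f a))"
    using d F by (intro sum.cong refl)
      (simp add: sum_representation_some_basis[OF fd V] dual_families_def)
  finally show ?thesis .
qed

lemma trace_on_commute:
  assumes fd: "\<exists>S::'a::real_vector set. finite S \<and> span S = UNIV"
    and V: "subspace (V :: 'a set)"
    and F: "linear F" "\<And>Z. Z \<in> V \<Longrightarrow> F Z \<in> V"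
    and G: "linear G" "\<And>Z. Z \<in> V \<Longrightarrow> G Z \<in> V"
  shows "trace_on V (\<lambda>Z. F (G Z)) = trace_on V (\<lambda>Z. G (F Z))"
proof -
  let ?E = "some_basis V"
  let ?r = "representation ?E"
  note E = some_basis[OF V]
  have *: "?r (F (G u)) u = (\<Sum>v\<in>?E. ?r (G u) v * ?r (F v) u)"
    if u: "u \<in> ?E" and F: "linear F" "\<And>Z. Z \<in> V \<Longrightarrow> F Z \<in> V"
      and G: "linear G" "\<And>Z. Z \<in> V \<Longrightarrow> G Z \<in> V" for u F G
  proof -
    have sub: "v \<in> V" if "v \<in> ?E" for v
      using that some_basis_subset[OF V] by auto
    have "F (G u) = F (\<Sum>v\<in>?E. ?r (G u) v *\<^sub>R v)"
      using sum_representation_some_basis[OF fd V, of "G u"] G sub u by simp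
    also have "\<dots> = (\<Sum>v\<in>?E. ?r (G u) v *\<^sub>R F v)"
      using F by (simp add: linear_sum linear_cmul)
    finally have "?r (F (G u)) = ?r (\<Sum>v\<in>?E. ?r (G u) v *\<^sub>R F v)"
      by simp
    also have "\<dots> = (\<lambda>b. \<Sum>v\<in>?E. ?r (?r (G u) v *\<^sub>R F v) b)"
      using F E sub by (intro representation_sum) (auto simp: V subspace_scale)
    also have "\<dots> = (\<lambda>b. \<Sum>v\<in>?E. ?r (G u) v * ?r (F v) b)"
      using F E sub by (intro ext sum.cong refl, subst representation_scale) auto
    finally show ?thesis
      by simp
  qed
  have "trace_on V (\<lambda>Z. F (G Z)) = (\<Sum>u\<in>?E. \<Sum>v\<in>?E. ?r (G u) v * ?r (F v) u)"
    unfolding trace_on_def using *[OF _ F G] by simp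
  also have "\<dots> = (\<Sum>v\<in>?E. \<Sum>u\<in>?E. ?r (F v) u * ?r (G u) v)"
    by (subst sum.swap) (simp add: mult.commute)
  also have "\<dots> = trace_on V (\<lambda>Z. G (F Z))"
    unfolding trace_on_def using *[OF _ G F] by simp
  finally show ?thesis .
qed

lemma dual_vector:
  assumes fd: "\<exists>S::'a::real_vector set. finite S \<and> span S = UNIV"
    and V: "subspace V" and B: "bilinear B"
    and nd: "\<forall>w\<in>V. (\<forall>v\<in>V. B v w = 0) \<longrightarrow> w = (0::'a)"
    and e: "e \<in> some_basis V"
  shows "dual_vector B V (some_basis V) e \<in> V"
    and "e' \<in> some_basis V \<Longrightarrow> B e' (dual_vector B V (some_basis V) e) = (if e' = e then 1 else 0)"
proof -
  let ?E = "some_basis V"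
  note E = some_basis[OF V]
  have fin: "finite ?E"
    by (rule finite_some_basis[OF fd V])
  \<comment> \<open>\<open>\<Phi>\<close> records the values of \<open>B\<close> against the basis
    as coordinates, so a vector dual to \<open>e\<close> is a preimage of \<open>e\<close>.
    Non-degeneracy makes it injective on \<open>V\<close>.\<close>
  define \<Phi> where "\<Phi> w = (\<Sum>u\<in>?E. B u w *\<^sub>R u)" for w
  have lin: "linear \<Phi>"
    unfolding \<Phi>_def
    by (rule linearI) (simp_all add: bilinear_radd[OF B] bilinear_rmul[OF B] scaleR_add_left
        sum.distrib scaleR_sum_right)
  have zero: "w = 0" if "w \<in> V" "\<And>u. u \<in> ?E \<Longrightarrow> B u w = 0" for w
  proof -
    have "B v w = 0" if "v \<in> V" for v
    proof -
    have "linear (\<lambda>v. B v w)"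
      using B by (simp add: bilinear_def)
    then show ?thesis
      using linear_eq_0_on_span[of "\<lambda>v. B v w" ?E v] \<open>v \<in> V\<close> E(2)
        \<open>\<And>u. u \<in> ?E \<Longrightarrow> B u w = 0\<close> by auto
    qed
    then show ?thesis
      using nd \<open>w \<in> V\<close> by blast
  qed
  have coeff: "B u w = a u" if "\<Phi> w = (\<Sum>u\<in>?E. a u *\<^sub>R u)" "u \<in> ?E" for w a u
  proof -
    have "(\<Sum>u\<in>?E. (B u w - a u) *\<^sub>R u) = 0"
      using that by (simp add: \<Phi>_def scaleR_diff_left sum_subtractf)
    then show ?thesis
      using independentD[OF E(1) fin subset_refl, of "\<lambda>u. B u w - a u" u] that(2) by simp
  qed
  have inj: "inj_on \<Phi> (span ?E)"
  proof (rule inj_onI)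
    fix v w assume vw: "v \<in> span ?E" "w \<in> span ?E" "\<Phi> v = \<Phi> w"
    have "v - w = 0"
    proof (rule zero)
      show "v - w \<in> V"
        using vw E(2) V by (simp add: subspace_diff)
      show "B u (v - w) = 0" if "u \<in> ?E" for u
        using coeff[of v "\<lambda>u. B u w" u] vw(3) that by (simp add: \<Phi>_def bilinear_rsub[OF B])
    qed
    then show "v = w" by simp
  qed
  have ind: "independent (\<Phi> ` ?E)"
    by (rule linear_independent_injective_image[OF lin E(1) inj])
  have card: "card (\<Phi> ` ?E) = card ?E"
    using inj span_superset by (intro card_image) (rule inj_on_subset)
  have sub: "\<Phi> ` ?E \<subseteq> span ?E"
    unfolding \<Phi>_def by (auto intro!: span_sum intro: span_scale span_base)
  \<comment> \<open>Surjectivity by counting: otherwise \<open>e\<close> and the images of the basis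
    would be more independent vectors than \<open>?E\<close> has elements.\<close>
  have "e \<in> span (\<Phi> ` ?E)"
  proof (rule ccontr)
    assume ne: "e \<notin> span (\<Phi> ` ?E)"
    then have "independent (insert e (\<Phi> ` ?E))"
      using ind by (simp add: independent_insert)
    moreover have "insert e (\<Phi> ` ?E) \<subseteq> span ?E"
      using e sub by (auto intro: span_base)
    ultimately have "card (insert e (\<Phi> ` ?E)) \<le> card ?E"
      by (meson independent_span_bound[OF fin])
    moreover have "e \<notin> \<Phi> ` ?E"
      using ne span_base[of e "\<Phi> ` ?E"] by metis
    ultimately show False
      using card fin card_insert_disjoint[of "\<Phi> ` ?E" e] by (metis finite_imageI not_less_eq_eq order_refl)
  qed
  then obtain w where w: "w \<in> V" "\<Phi> w = e"
    using lin E(2) by (auto simp: linear_span_image)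
  have "\<Phi> w = (\<Sum>u\<in>?E. (if u = e then 1 else 0) *\<^sub>R u)"
    using w(2) e fin by (simp add: if_distrib[of "\<lambda>r. r *\<^sub>R _"] cong: if_cong)
  then have Bw: "B u w = (if u = e then 1 else 0)" if "u \<in> ?E" for u
    using coeff[of w "\<lambda>u. if u = e then 1 else 0"] that by simp
  have "dual_vector B V ?E e \<in> V \<and>
      (\<forall>e'\<in>?E. B e' (dual_vector B V ?E e) = (if e' = e then 1 else 0))"
    unfolding dual_vector_def
  proof (rule theI)
    show "w \<in> V \<and> (\<forall>e'\<in>?E. B e' w = (if e' = e then 1 else 0))"
      using w Bw by auto
    fix v assume v: "v \<in> V \<and> (\<forall>e'\<in>?E. B e' v = (if e' = e then 1 else 0))"
    have "v - w = 0"
      using v w Bw V by (intro zero) (auto simp: bilinear_rsub[OF B] subspace_diff)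
    then show "v = w" by simp
  qed
  then show "dual_vector B V ?E e \<in> V"
    and "e' \<in> ?E \<Longrightarrow> B e' (dual_vector B V ?E e) = (if e' = e then 1 else 0)"
    by auto
qed

lemma dual_families_dual_vector:
  assumes fd: "\<exists>S::'a::real_vector set. finite S \<and> span S = UNIV"
    and V: "subspace V" and B: "bilinear B"
    and nd: "\<forall>w\<in>V. (\<forall>v\<in>V. B v w = 0) \<longrightarrow> w = (0::'a)"
  shows "dual_families B V (some_basis V) (\<lambda>e. e) (dual_vector B V (some_basis V))"
  unfolding dual_families_def
proof (intro conjI ballI)
  let ?E = "some_basis V"
  let ?d = "dual_vector B V ?E"
  note dual = dual_vector[OF fd V B nd]
  show fin: "finite ?E"
    by (rule finite_some_basis[OF fd V])
  show "u \<in> V" if "u \<in> ?E" for u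
    using that some_basis_subset[OF V] by auto
  show "?d u \<in> V" if "u \<in> ?E" for u
    using dual(1) that by auto
  show "(\<Sum>u\<in>?E. B v (?d u) *\<^sub>R u) = v" if "v \<in> V" for v
  proof -
    let ?r = "representation ?E v"
    have v: "v = (\<Sum>w\<in>?E. ?r w *\<^sub>R w)"
      using sum_representation_some_basis[OF fd V that] by simp
    have "B v (?d u) = ?r u" if u: "u \<in> ?E" for u
    proof -
      have "B v (?d u) = (\<Sum>w\<in>?E. ?r w * B w (?d u))"
        by (subst v) (simp add: bilinear_sum_left[OF B] bilinear_lmul[OF B])
      also have "\<dots> = (\<Sum>w\<in>?E. ?r w * (if w = u then 1 else 0))"
        using dual(2)[OF u] by (intro sum.cong) auto
      also have "\<dots> = ?r u"
        using fin u by (simp add: if_distrib cong: if_cong)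
      finally show ?thesis .
    qed
    then show ?thesis
      by (subst v) simp
  qed
qed

text \<open>Contracts a pair of dual bases; the sums over a basis of \<open>g 1\<close> in
  \<open>trace_odd_scal\<close> disappear this way.\<close>

lemma dual_families_expand:
  assumes "bilinear B" "dual_families B V I e f" "w \<in> V"
  shows "(\<Sum>a\<in>I. B (e a) v * B w (f a)) = B w v"
proof -
  have "B w v = B (\<Sum>a\<in>I. B w (f a) *\<^sub>R e a) v"
    using assms by (simp add: dual_families_def)
  then show ?thesis
    by (simp add: bilinear_sum_left[OF assms(1)] bilinear_lmul[OF assms(1)] mult.commute)
qed

text \<open>Each \<open>f a\<close> is a combination of the \<open>e b\<close> with coefficients
  from the Gram matrix of \<open>f\<close>, and this matrix is symmetric.\<close>

lemma dual_families_sum_swap: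
  assumes B: "bilinear B" and d: "dual_families B V I e f"
    and sym: "\<And>v w. v \<in> V \<Longrightarrow> w \<in> V \<Longrightarrow> B v w = B w v"
    and \<phi>: "bilinear \<phi>"
  shows "(\<Sum>a\<in>I. \<phi> (e a) (f a)) = (\<Sum>a\<in>I. \<phi> (f a) (e a))"
proof -
  have f: "f a = (\<Sum>b\<in>I. B (f a) (f b) *\<^sub>R e b)" if "a \<in> I" for a
    using d that by (simp add: dual_families_def)
  have "(\<Sum>a\<in>I. \<phi> (e a) (f a)) = (\<Sum>a\<in>I. \<Sum>b\<in>I. B (f a) (f b) *\<^sub>R \<phi> (e a) (e b))"
    by (rule sum.cong[OF refl], subst f)
      (simp_all add: bilinear_sum_right[OF \<phi>] bilinear_rmul[OF \<phi>])
  also have "\<dots> = (\<Sum>b\<in>I. \<Sum>a\<in>I. B (f b) (f a) *\<^sub>R \<phi> (e a) (e b))"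
    using d by (subst sum.swap) (auto simp: dual_families_def intro!: sum.cong sym arg_cong2[of _ _ _ _ scaleR])
  also have "\<dots> = (\<Sum>b\<in>I. \<phi> (f b) (e b))"
    by (rule sum.cong[OF refl], subst (2) f)
      (simp_all add: bilinear_sum_left[OF \<phi>] bilinear_lmul[OF \<phi>])
  finally show ?thesis .
qed

section \<open>Levi-Civita connections on Lie superalgebras\<close>

lemma parity_sign_simps [simp]:
  "parity_sign 0 q = 1" "parity_sign p 0 = 1" "parity_sign 1 1 = -1"
  by (simp_all add: parity_sign_def)

lemma bit_add_simps: "0 + q = (q::bit)" "q + 0 = (q::bit)" "1 + 1 = (0::bit)"
  by simp_all

context lie_superalgebra
begin

lemma subspace_g: "subspace (g p)"
  using grading by (cases p) (auto simp: direct_sum_def)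

lemma part_in: "part g p X \<in> g p"
  using direct_sum_component(1)[OF grading] by (cases p) auto

lemma part_sum: "part g 0 X + part g 1 X = X"
  using direct_sum_component(2)[OF grading, of X] by simp

lemma linear_part: "linear (part g p)"
  by (rule linearI; cases p) (simp_all add: component_add[OF grading] component_scale[OF grading])

lemma part_same: "X \<in> g p \<Longrightarrow> part g p X = X"
  using component_summand[OF grading, of p X p] by (cases p) auto

lemma part_other: "X \<in> g p \<Longrightarrow> q \<noteq> p \<Longrightarrow> part g q X = 0"
  using component_summand[OF grading, of p X q] by (cases p; cases q) auto

lemmas br_simps = bilinear_simps[OF bilinear_br]

lemma br_00: "X \<in> g 0 \<Longrightarrow> Y \<in> g 0 \<Longrightarrow> br X Y \<in> g 0"
  and br_01: "X \<in> g 0 \<Longrightarrow> Y \<in> g 1 \<Longrightarrow> br X Y \<in> g 1"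
  and br_10: "X \<in> g 1 \<Longrightarrow> Y \<in> g 0 \<Longrightarrow> br X Y \<in> g 1"
  and br_11: "X \<in> g 1 \<Longrightarrow> Y \<in> g 1 \<Longrightarrow> br X Y \<in> g 0"
  using even_br[of X 0 Y 0] even_br[of X 0 Y 1] even_br[of X 1 Y 0] even_br[of X 1 Y 1]
  by (simp_all add: bit_add_simps)

lemma skew_even: "X \<in> g 0 \<Longrightarrow> br X Y = - br Y X"
proof -
  assume X: "X \<in> g 0"
  have "br X (part g 0 Y + part g 1 Y) = - br (part g 0 Y + part g 1 Y) X"
    using super_skew[OF X part_in[of 0 Y]] super_skew[OF X part_in[of 1 Y]]
    by (simp add: br_simps)
  then show ?thesis by (simp add: part_sum)
qed

lemma jacobi_even:
  assumes "X \<in> g 0"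
  shows "br X (br Y Z) = br (br X Y) Z + br Y (br X Z)"
proof -
  have "br X (br (part g 0 Y + part g 1 Y) (part g 0 Z + part g 1 Z)) =
      br (br X (part g 0 Y + part g 1 Y)) (part g 0 Z + part g 1 Z) +
      br (part g 0 Y + part g 1 Y) (br X (part g 0 Z + part g 1 Z))"
    using super_jacobi[OF assms part_in[of 0 Y] part_in[of 0 Z]]
      super_jacobi[OF assms part_in[of 0 Y] part_in[of 1 Z]]
      super_jacobi[OF assms part_in[of 1 Y] part_in[of 0 Z]]
      super_jacobi[OF assms part_in[of 1 Y] part_in[of 1 Z]]
    by (simp add: br_simps)
  then show ?thesis by (simp add: part_sum)
qed

text \<open>The difference \<open>S\<close> of two connections makes \<open>f (S X Y) Z\<close> supersymmetric in \<open>X, Y\<close> and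
  skew in \<open>Y, Z\<close>; going through all six permutations of the arguments changes its sign.\<close>

lemma is_levi_civita_unique:
  assumes f: "is_metric g f"
    and D: "is_levi_civita g br f D" and D': "is_levi_civita g br f D'"
  shows "D = D'"
proof -
  have bf: "bilinear f" and nd: "\<And>X. (\<And>Y. f X Y = 0) \<Longrightarrow> X = 0"
    and sym: "\<And>p q X Y. X \<in> g p \<Longrightarrow> Y \<in> g q \<Longrightarrow> f X Y = parity_sign p q * f Y X"
    using f unfolding is_metric_def by blast+
  define S where "S X Y = D X Y - D' X Y" for X Y
  have S_in: "S X Y \<in> g (p + q)" if "X \<in> g p" "Y \<in> g q" for X Y p q
    unfolding S_def
    by (rule subspace_diff[OF subspace_g])
      (use D D' that in \<open>simp_all add: is_levi_civita_def del: add_bit_eq_xor\<close>)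
  have S_swap: "S X Y = parity_sign p q *\<^sub>R S Y X" if "X \<in> g p" "Y \<in> g q" for X Y p q
  proof -
    have "D X Y - parity_sign p q *\<^sub>R D Y X = D' X Y - parity_sign p q *\<^sub>R D' Y X"
      using D D' that by (simp add: is_levi_civita_def)
    then show ?thesis
      by (simp add: S_def algebra_simps)
  qed
  have T_swap: "f (S X Y) Z = parity_sign p q * f (S Y X) Z" if "X \<in> g p" "Y \<in> g q" for X Y Z p q
    using S_swap[OF that] bilinear_lmul[OF bf] by simp
  have T_skew: "f (S X Y) Z = - (parity_sign q r * f (S X Z) Y)"
    if "X \<in> g p" "Y \<in> g q" "Z \<in> g r" for X Y Z p q r
  proof -
    have "f (D X Y) Z + parity_sign p q * f Y (D X Z) = 0"
      "f (D' X Y) Z + parity_sign p q * f Y (D' X Z) = 0"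
      using D D' that by (auto simp: is_levi_civita_def)
    then have "f (S X Y) Z = - (parity_sign p q * f Y (S X Z))"
      by (simp add: S_def bilinear_simps[OF bf] algebra_simps)
    \<comment> \<open>The sign is a bicharacter: its factor for \<open>(q, p)\<close> cancels the
      sign for \<open>(p, q)\<close> already present and leaves the one for
      \<open>(q, r)\<close>.\<close>
    also have "f Y (S X Z) = parity_sign q (p + r) * f (S X Z) Y"
      using that by (intro sym S_in)
    finally show ?thesis
      by (cases p; cases q; cases r) (simp_all add: bit_add_simps del: add_bit_eq_xor)
  qed
  \<comment> \<open>Three exchanges and three skew moves lead back to the start. The parity sign of
    each pair occurs twice and cancels, so only the three minus signs remain.\<close>
  have T0: "f (S X Y) Z = 0" if "X \<in> g p" "Y \<in> g q" "Z \<in> g r" for X Y Z p q r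
    using T_swap[OF that(1,2), of Z] T_skew[OF that(2,1,3)] T_swap[OF that(2,3), of X]
      T_skew[OF that(3,2,1)] T_swap[OF that(3,1), of Y] T_skew[OF that]
    by (cases p; cases q; cases r) simp_all
  have S0: "S X Y = 0" if "X \<in> g p" "Y \<in> g q" for X Y p q
  proof (rule nd)
    fix Z
    have "f (S X Y) (part g 0 Z + part g 1 Z) = 0"
      using T0[OF that part_in] by (simp add: bilinear_radd[OF bf])
    then show "f (S X Y) Z = 0"
      by (simp add: part_sum)
  qed
  have bil: "bilinear S"
    using D D' unfolding S_def is_levi_civita_def bilinear_def by (simp add: linear_compose_sub)
  show ?thesis
  proof (intro ext)
    fix X Y
    have "S (part g 0 X + part g 1 X) (part g 0 Y + part g 1 Y) = 0"
      using S0[OF part_in part_in] by (simp add: bilinear_simps[OF bil])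
    then show "D X Y = D' X Y"
      by (simp add: part_sum S_def)
  qed
qed

lemma levi_civita_eqI:
  assumes "is_metric g f" "is_levi_civita g br f D"
  shows "levi_civita g br f = D"
  unfolding levi_civita_def
  using is_levi_civita_unique[OF assms(1)] assms(2) by (intro the_equality) auto

lemma curvature_homogeneous:
  assumes "X \<in> g p" "Y \<in> g q" "bilinear (levi_civita g br f)"
  shows "curvature g br f X Y Z =
    levi_civita g br f X (levi_civita g br f Y Z)
    - parity_sign p q *\<^sub>R levi_civita g br f Y (levi_civita g br f X Z)
    - levi_civita g br f (br X Y) Z"
  using assms(1,2) unfolding curvature_def Let_def
  by (cases p; cases q)
    (simp_all add: part_same part_other bilinear_simps[OF assms(3)] br_simps)

lemma linear_curvature:
  assumes "bilinear (levi_civita g br f)"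
  shows "linear (\<lambda>X. curvature g br f X Y Z)" "linear (\<lambda>Y. curvature g br f X Y Z)"
    "linear (\<lambda>Z. curvature g br f X Y Z)"
  unfolding curvature_def Let_def
  by (rule linearI; simp add: bilinear_simps[OF assms] br_simps linear_add[OF linear_part]
      linear_cmul[OF linear_part] algebra_simps)+

end

section \<open>Superalgebras with reductive even part and a bi-invariant metric\<close>

text \<open>The orthogonality of the \<open>k i\<close> and the non-degeneracy of \<open>B\<close>
  on each of them are derived below from invariance.\<close>

locale reductive_superalgebra = lie_superalgebra g br
  for g :: "bit \<Rightarrow> 'a::real_vector set" and br :: "'a \<Rightarrow> 'a \<Rightarrow> 'a" +
  fixes s :: nat and k :: "nat \<Rightarrow> 'a set" and B :: "'a \<Rightarrow> 'a \<Rightarrow> real"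
  assumes decomposition: "reductive_decomposition br (g 0) s k"
    and metric: "is_metric g B"
    and invariant: "bi_invariant br B"
begin

section \<open>The ideals of the even part\<close>

lemma direct_sum_k: "direct_sum {0..s} k (g 0)"
  using decomposition by (simp add: reductive_decomposition_def)

lemma k_subset: "i \<le> s \<Longrightarrow> k i \<subseteq> g 0"
  using direct_sum_k by (auto simp: direct_sum_def)

lemma subspace_k: "i \<le> s \<Longrightarrow> subspace (k i)"
  using direct_sum_k by (auto simp: direct_sum_def)

lemma k_even: "i \<le> s \<Longrightarrow> X \<in> k i \<Longrightarrow> X \<in> g 0"
  using k_subset by auto

lemma br_k: "i \<le> s \<Longrightarrow> X \<in> g 0 \<Longrightarrow> Y \<in> k i \<Longrightarrow> br X Y \<in> k i"
  using decomposition by (auto simp: reductive_decomposition_def is_ideal_def)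

lemma br_k': "i \<le> s \<Longrightarrow> Y \<in> k i \<Longrightarrow> X \<in> g 0 \<Longrightarrow> br Y X \<in> k i"
  using br_k[of i X Y] skew_even[of Y X] subspace_neg[OF subspace_k] by (auto simp: k_even)

lemma k_disjoint: "i \<le> s \<Longrightarrow> j \<le> s \<Longrightarrow> i \<noteq> j \<Longrightarrow> X \<in> k i \<Longrightarrow> X \<in> k j \<Longrightarrow> X = 0"
  using component_summand[OF direct_sum_k, of i X i] component_summand[OF direct_sum_k, of j X i]
  by auto

lemma br_k_other: "i \<le> s \<Longrightarrow> j \<le> s \<Longrightarrow> i \<noteq> j \<Longrightarrow> X \<in> k i \<Longrightarrow> Y \<in> k j \<Longrightarrow> br X Y = 0"
  using k_disjoint[of i j "br X Y"] br_k[of j X Y] br_k'[of i X Y] by (auto simp: k_even)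

lemma br_k0: "X \<in> k 0 \<Longrightarrow> Y \<in> k 0 \<Longrightarrow> br X Y = 0"
  using decomposition by (auto simp: reductive_decomposition_def is_abelian_def)

definition proj :: "nat \<Rightarrow> 'a \<Rightarrow> 'a" where
  "proj i X = component {0..s} k i (part g 0 X)"

text \<open>The operator \<open>A\<close> of the overview. The weights are a parameter because
  composition multiplies them and the weight 1 gives the identity, so one set of trace lemmas covers
  scaled and unscaled brackets.\<close>

definition scal :: "(nat \<Rightarrow> real) \<Rightarrow> 'a \<Rightarrow> 'a" where
  "scal y X = (\<Sum>i\<in>{0..s}. y i *\<^sub>R proj i X) + part g 1 X"

lemma proj_in: "i \<le> s \<Longrightarrow> proj i X \<in> k i"
  using direct_sum_component(1)[OF direct_sum_k part_in] by (simp add: proj_def)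

lemma sum_proj: "(\<Sum>i\<in>{0..s}. proj i X) = part g 0 X"
  using direct_sum_component(2)[OF direct_sum_k part_in] by (simp add: proj_def)

lemma linear_proj: "i \<le> s \<Longrightarrow> linear (proj i)"
  unfolding proj_def
  by (rule linearI) (simp_all add: linear_add[OF linear_part] linear_cmul[OF linear_part]
      component_add[OF direct_sum_k] component_scale[OF direct_sum_k] part_in)

lemma proj_k: "i \<le> s \<Longrightarrow> j \<le> s \<Longrightarrow> X \<in> k j \<Longrightarrow> proj i X = (if i = j then X else 0)"
  by (simp add: proj_def part_same k_even component_summand[OF direct_sum_k])

lemma proj_odd: "i \<le> s \<Longrightarrow> X \<in> g 1 \<Longrightarrow> proj i X = 0"
  using proj_k[of i 0 0] subspace_0[OF subspace_k[of 0]] linear_0[OF linear_proj[of i]]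
  by (simp add: proj_def part_other part_same[OF subspace_0[OF subspace_g]])

lemma linear_scal: "linear (scal y)"
  unfolding scal_def
  by (intro linear_compose_add linear_compose_sum linear_part ballI linear_compose_scale_right
      linear_proj) simp

lemma scal_k: "i \<le> s \<Longrightarrow> X \<in> k i \<Longrightarrow> scal y X = y i *\<^sub>R X"
  by (simp add: scal_def part_other[OF k_even] proj_k if_distrib[of "\<lambda>Z. _ *\<^sub>R Z"] cong: if_cong)

lemma scal_odd: "X \<in> g 1 \<Longrightarrow> scal y X = X"
  by (simp add: scal_def proj_odd part_same)

lemma scal_one: "scal (\<lambda>_. 1) X = X"
  by (simp add: scal_def sum_proj part_sum)

lemma scal_even: "X \<in> g 0 \<Longrightarrow> scal y X \<in> g 0"
  unfolding scal_def
  by (auto simp: part_other subspace_0[OF subspace_g] intro!: subspace_add[OF subspace_g]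
      subspace_sum[OF subspace_g] subspace_scale[OF subspace_g] k_even[OF _ proj_in])

text \<open>The derived algebra is an ideal, and it is not zero because a simple algebra is
  non-abelian by definition.\<close>

lemma k_perfect:
  assumes "1 \<le> i" "i \<le> s"
  shows "span {br U V |U V. U \<in> k i \<and> V \<in> k i} = k i"
proof -
  let ?S = "{br U V |U V. U \<in> k i \<and> V \<in> k i}"
  have simp: "is_simple br (k i)"
    using decomposition assms by (auto simp: reductive_decomposition_def)
  have sub: "span ?S \<subseteq> k i"
    using assms by (intro span_minimal subspace_k) (auto intro: br_k k_even)
  have "is_ideal br (k i) (span ?S)"
    unfolding is_ideal_def
  proof (intro conjI ballI)
    fix X Y assume "X \<in> k i" "Y \<in> span ?S"
    then show "br X Y \<in> span ?S"
      using sub by (intro span_base) auto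
  qed (use sub in auto)
  moreover have "span ?S \<noteq> {0}"
  proof
    assume z: "span ?S = {0}"
    have "br U V = 0" if "U \<in> k i" "V \<in> k i" for U V
      using span_base[of "br U V" ?S] that z by auto
    then show False
      using simp by (auto simp: is_simple_def is_abelian_def)
  qed
  ultimately show ?thesis
    using simp by (auto simp: is_simple_def)
qed

section \<open>Orthogonality and non-degeneracy of \<open>B\<close>\<close>

lemma bilinear_B: "bilinear B"
  using metric by (simp add: is_metric_def)

lemmas B_simps = bilinear_simps[OF bilinear_B]

lemma B_br: "B (br X Y) Z = B X (br Y Z)"
  using invariant by (simp add: bi_invariant_def)

lemma B_01: "X \<in> g 0 \<Longrightarrow> Y \<in> g 1 \<Longrightarrow> B X Y = 0"
  using metric by (simp add: is_metric_def)

lemma B_sym_even: "X \<in> g 0 \<Longrightarrow> Y \<in> g 0 \<Longrightarrow> B X Y = B Y X"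
  and B_skew_odd: "X \<in> g 1 \<Longrightarrow> Y \<in> g 1 \<Longrightarrow> B X Y = - B Y X"
  and B_10: "X \<in> g 1 \<Longrightarrow> Y \<in> g 0 \<Longrightarrow> B X Y = 0"
proof -
  have *: "B X Y = parity_sign p q * B Y X" if "X \<in> g p" "Y \<in> g q" for p q
    using metric that unfolding is_metric_def by blast
  show "X \<in> g 0 \<Longrightarrow> Y \<in> g 0 \<Longrightarrow> B X Y = B Y X"
    "X \<in> g 1 \<Longrightarrow> Y \<in> g 1 \<Longrightarrow> B X Y = - B Y X"
    "X \<in> g 1 \<Longrightarrow> Y \<in> g 0 \<Longrightarrow> B X Y = 0"
    using *[of 0 0] *[of 1 1] *[of 1 0] B_01[of Y X] by simp_all
qed

lemma B_nondegenerate: "(\<And>Y. B X Y = 0) \<Longrightarrow> X = 0"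
  using metric by (simp add: is_metric_def)

text \<open>If the ideal of the left argument is perfect, invariance turns
  \<open>B (br U V) Y\<close> into \<open>B U (br V Y)\<close>, and \<open>V\<close> commutes with
  \<open>Y\<close>.\<close>

lemma B_k_other:
  assumes "i \<le> s" "j \<le> s" "i \<noteq> j" "X \<in> k i" "Y \<in> k j"
  shows "B X Y = 0"
proof -
  have *: "B X Y = 0" if "1 \<le> i" "i \<le> s" "j \<le> s" "i \<noteq> j" "X \<in> k i" "Y \<in> k j" for i j X Y
  proof -
    have "X \<in> span {br U V |U V. U \<in> k i \<and> V \<in> k i}"
      using that k_perfect by simp
    moreover have "linear (\<lambda>X. B X Y)"
      using bilinear_B by (simp add: bilinear_def)
    ultimately show ?thesis
    proof (rule linear_eq_0_on_span[rotated 2])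
      fix Z assume "Z \<in> {br U V |U V. U \<in> k i \<and> V \<in> k i}"
      then show "B Z Y = 0"
        using that by (auto simp: B_br B_simps br_k_other)
    qed
  qed
  show ?thesis
  proof (cases "i = 0")
    \<comment> \<open>\<open>k 0\<close> is abelian, so the perfect ideal is now \<open>k j\<close>;
      symmetry on \<open>g 0\<close> brings it to the left.\<close>
    case True
    then have "B Y X = 0"
      using assms by (intro *[of j i]) auto
    then show ?thesis
      using B_sym_even[of X Y] assms k_even by auto
  next
    case False
    then show ?thesis
      using assms by (intro *[of i j]) auto
  qed
qed

lemma B_proj: "i \<le> s \<Longrightarrow> Y \<in> k i \<Longrightarrow> B (proj i X) Y = B X Y"
proof -
  assume i: "i \<le> s" "Y \<in> k i"
  have "B X Y = B ((\<Sum>j\<in>{0..s}. proj j X) + part g 1 X) Y"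
    by (simp add: sum_proj part_sum)
  also have "\<dots> = (\<Sum>j\<in>{0..s}. B (proj j X) Y)"
    using i by (simp add: B_simps bilinear_sum_left[OF bilinear_B] B_10[OF part_in] k_even)
  also have "\<dots> = (\<Sum>j\<in>{0..s}. if j = i then B (proj i X) Y else 0)"
    using i by (intro sum.cong) (auto intro: B_k_other proj_in)
  finally show ?thesis
    using i by simp
qed

lemma B_part: "Y \<in> g p \<Longrightarrow> B (part g p X) Y = B X Y"
proof -
  assume Y: "Y \<in> g p"
  have "B X Y = B (part g 0 X + part g 1 X) Y"
    by (simp add: part_sum)
  also have "\<dots> = B (part g p X) Y"
    using Y by (cases p) (simp_all add: B_simps B_10[OF part_in] B_01[OF part_in])
  finally show ?thesis ..
qed

text \<open>Pairing with \<open>X\<close> sees only the component in \<open>k i\<close>, so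
  \<open>X\<close> is orthogonal to the whole algebra.\<close>

lemma nondegenerate_k:
  assumes "i \<le> s" "X \<in> k i" "\<And>Y. Y \<in> k i \<Longrightarrow> B Y X = 0"
  shows "X = 0"
proof (rule B_nondegenerate)
  fix Y
  have "B Y X = 0"
    using assms B_proj[of i X Y] proj_in by auto
  moreover have "B X Y = B X (part g 0 Y)"
    using assms B_01[OF k_even part_in[of 1 Y], of i X] part_sum[of Y]
    by (metis add.right_neutral bilinear_radd[OF bilinear_B])
  ultimately show "B X Y = 0"
    using B_part[of X 0 Y] B_sym_even[of X "part g 0 Y"] assms part_in k_even by auto
qed

lemma nondegenerate_odd:
  assumes "X \<in> g 1" "\<And>Y. Y \<in> g 1 \<Longrightarrow> B Y X = 0"
  shows "X = 0"
proof (rule B_nondegenerate)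
  fix Y
  have "B X Y = B X (part g 1 Y)"
    using B_10[OF assms(1) part_in[of 0 Y]] part_sum[of Y]
    by (metis add.left_neutral bilinear_radd[OF bilinear_B])
  then show "B X Y = 0"
    using B_skew_odd[OF assms(1) part_in[of 1 Y]] assms(2) part_in by auto
qed

text \<open>A spanning set on whose pieces \<open>scal\<close> is a scalar; bilinear identities are
  checked only here.\<close>

definition homogeneous :: "'a set" where
  "homogeneous = (\<Union>i\<in>{0..s}. k i) \<union> g 1"

lemma homogeneousE:
  assumes "X \<in> homogeneous"
  obtains i where "i \<le> s" "X \<in> k i" | "X \<in> g 1"
  using assms by (auto simp: homogeneous_def)

lemma span_homogeneous: "span homogeneous = UNIV"
proof -
  have "X \<in> span homogeneous" for X
  proof -
    have "(\<Sum>i\<in>{0..s}. proj i X) + part g 1 X \<in> span homogeneous"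
      by (intro span_add span_sum span_base) (auto simp: homogeneous_def part_in intro!: proj_in)
    then show ?thesis
      by (simp add: sum_proj part_sum)
  qed
  then show ?thesis by auto
qed

lemma bilinear_eq_homogeneous:
  assumes "bilinear F" "bilinear G"
    and "\<And>X Y. X \<in> homogeneous \<Longrightarrow> Y \<in> homogeneous \<Longrightarrow> F X Y = G X Y"
  shows "F X Y = G X Y"
  by (rule bilinear_eq[OF assms(1,2), of UNIV homogeneous UNIV homogeneous])
    (simp_all add: span_homogeneous assms(3))

lemma scal_in: "X \<in> g p \<Longrightarrow> scal y X \<in> g p"
  by (cases p) (simp_all add: scal_even scal_odd)

lemma B_part_right: "X \<in> g p \<Longrightarrow> B X (part g p Y) = B X Y"
proof -
  assume X: "X \<in> g p"
  have "B X Y = B X (part g 0 Y + part g 1 Y)"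
    by (simp add: part_sum)
  also have "\<dots> = B X (part g p Y)"
    using X by (cases p) (simp_all add: B_simps B_10[OF _ part_in] B_01[OF _ part_in])
  finally show ?thesis ..
qed

lemma B_proj_right:
  assumes "i \<le> s" "X \<in> k i"
  shows "B X (proj i Y) = B X Y"
proof -
  have X: "X \<in> g 0"
    using assms by (rule k_even)
  have "B X (proj i Y) = B (proj i Y) X"
    by (rule B_sym_even[OF X k_even[OF assms(1) proj_in[OF assms(1)]]])
  also have "\<dots> = B (part g 0 Y) X"
    using assms X by (simp add: B_proj B_part)
  also have "\<dots> = B X Y"
    using X B_sym_even[OF X part_in] B_part_right[OF X] by simp
  finally show ?thesis .
qed

text \<open>The projections belong to an orthogonal decomposition and are therefore
  self-adjoint.\<close>

lemma B_scal: "B (scal y X) Y = B X (scal y Y)"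
proof -
  have "B (proj i X) Y = B X (proj i Y)" if "i \<in> {0..s}" for i
    using that B_proj_right[of i "proj i X" Y] B_proj[of i "proj i Y" X] proj_in by simp
  moreover have "B (part g 1 X) Y = B X (part g 1 Y)"
    using B_part_right[OF part_in, of 1 X Y] B_part[OF part_in, of 1 X Y] by simp
  ultimately show ?thesis
    by (simp add: scal_def B_simps bilinear_sum_left[OF bilinear_B]
        bilinear_sum_right[OF bilinear_B])
qed

lemma scal_scal: "scal y (scal z X) = scal (\<lambda>i. y i * z i) X"
proof -
  have "scal y (scal z X) = (\<Sum>i\<in>{0..s}. z i *\<^sub>R scal y (proj i X)) + scal y (part g 1 X)"
    unfolding scal_def[of z] using linear_scal[of y]
    by (simp add: linear_add linear_sum linear_cmul)
  also have "\<dots> = scal (\<lambda>i. y i * z i) X"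
    by (simp add: scal_k[OF _ proj_in] scal_odd[OF part_in] scal_def[of "\<lambda>i. y i * z i"] mult.commute)
  finally show ?thesis .
qed

lemma scal_eq_0:
  assumes "\<forall>i\<in>{0..s}. y i \<noteq> 0" "scal y X = 0"
  shows "X = 0"
proof -
  have "X = scal (\<lambda>_. 1) X"
    by (simp add: scal_one)
  also have "\<dots> = scal (\<lambda>i. inverse (y i) * y i) X"
    using assms(1) by (simp add: scal_def)
  also have "\<dots> = scal (\<lambda>i. inverse (y i)) (scal y X)"
    by (simp add: scal_scal)
  also have "\<dots> = 0"
    using assms(2) linear_0[OF linear_scal] by simp
  finally show ?thesis .
qed

section \<open>The scaled metric and its connection\<close>

lemma scaled_metric_eq: "scaled_metric g s k B y X Y = B (scal y X) Y"
  using B_part_right[OF part_in, of 1 X Y]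
  by (simp add: scaled_metric_def scal_def B_simps bilinear_sum_left[OF bilinear_B]
      B_proj_right[OF _ proj_in] flip: proj_def)

lemma is_metric_scaled_metric:
  assumes "\<forall>i\<in>{0..s}. y i \<noteq> 0"
  shows "is_metric g (scaled_metric g s k B y)"
  unfolding is_metric_def scaled_metric_eq
proof (intro conjI allI ballI impI)
  show "bilinear (\<lambda>X Y. B (scal y X) Y)"
    by (rule bilinear_comp_linear[OF bilinear_B linear_scal linear_id[unfolded id_def]])
  show "B (scal y X) Y = 0" if "X \<in> g 0" "Y \<in> g 1" for X Y
    using that by (intro B_01 scal_even)
  show "B (scal y X) Y = parity_sign p q * B (scal y Y) X" if "X \<in> g p" "Y \<in> g q" for p q X Y
  proof -
    have "B (scal y X) Y = parity_sign p q * B Y (scal y X)"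
      using metric scal_in[OF that(1)] that(2) unfolding is_metric_def by blast
    then show ?thesis
      by (simp add: B_scal)
  qed
  show "X = 0" if "\<forall>Y. B (scal y X) Y = 0" for X
    using that B_nondegenerate scal_eq_0[OF assms] by blast
qed

text \<open>With \<open>A = scal y\<close>, the Koszul formula for \<open>B (A X) Y\<close> has the inverse of \<open>A\<close> in front of
  \<open>[X, A Y] - [A X, Y]\<close>.  It can be dropped: this difference vanishes for \<open>X, Y\<close> of equal parity,
  and otherwise lies in \<open>g 1\<close>, where \<open>A\<close> is the identity.\<close>

definition nabla :: "(nat \<Rightarrow> real) \<Rightarrow> 'a \<Rightarrow> 'a \<Rightarrow> 'a" where
  "nabla y X Y = (1/2) *\<^sub>R (br X Y + br X (scal y Y) - br (scal y X) Y)"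

lemma bilinear_nabla: "bilinear (nabla y)"
  unfolding bilinear_def nabla_def
  by (auto intro!: linearI simp: br_simps linear_add[OF linear_scal] linear_cmul[OF linear_scal]
      algebra_simps)

lemmas nabla_simps = bilinear_simps[OF bilinear_nabla]

text \<open>With \<open>W = X - scal y X\<close> this says that \<open>scal y\<close> commutes with
  \<open>br W\<close>, the fact on which metric compatibility rests. \<open>W\<close> is zero for
  odd \<open>X\<close>; for \<open>X\<close> in \<open>k i\<close>, \<open>br W\<close> preserves
  each summand, on which \<open>scal y\<close> is a scalar.\<close>

lemma scal_br:
  "scal y (br X Z) - scal y (br (scal y X) Z) = br X (scal y Z) - br (scal y X) (scal y Z)"
proof -
  have bil: "bilinear (\<lambda>X Z. scal y (br X Z) - scal y (br (scal y X) Z))"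
    "bilinear (\<lambda>X Z. br X (scal y Z) - br (scal y X) (scal y Z))"
    unfolding bilinear_def
    by (auto intro!: linearI simp: br_simps linear_add[OF linear_scal] linear_cmul[OF linear_scal]
      algebra_simps)
  show ?thesis
  proof (rule bilinear_eq_homogeneous[OF bil])
    fix X Z assume "X \<in> homogeneous" "Z \<in> homogeneous"
    then show "scal y (br X Z) - scal y (br (scal y X) Z) =
        br X (scal y Z) - br (scal y X) (scal y Z)"
    proof (elim homogeneousE)
      fix i j assume *: "i \<le> s" "X \<in> k i" "j \<le> s" "Z \<in> k j"
      show ?thesis
      proof (cases "i = j")
        case True
        then have "br X Z \<in> k i"
          using * by (intro br_k k_even) auto
        then show ?thesis
          using * True by (simp add: scal_k br_simps linear_cmul[OF linear_scal])
      next
        case False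
        then show ?thesis
          using * br_k_other[of i j X Z]
          by (simp add: scal_k br_simps linear_cmul[OF linear_scal] linear_0[OF linear_scal])
      qed
    next
      fix i assume "i \<le> s" "X \<in> k i" "Z \<in> g 1"
      then show ?thesis
        using br_01[OF k_even, of i X Z] by (simp add: scal_k scal_odd br_simps linear_cmul[OF linear_scal])
    next
      fix i assume "i \<le> s" "Z \<in> k i" "X \<in> g 1"
      then show ?thesis
        by (simp add: scal_k scal_odd br_simps)
    next
      assume "X \<in> g 1" "Z \<in> g 1"
      then show ?thesis
        by (simp add: scal_odd)
    qed
  qed
qed

lemma is_levi_civita_nabla: "is_levi_civita g br (scaled_metric g s k B y) (nabla y)"
  unfolding is_levi_civita_def
proof (intro conjI allI ballI)
  show "bilinear (nabla y)"
    by (rule bilinear_nabla)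
  show "nabla y X Y \<in> g (p + q)" if "X \<in> g p" "Y \<in> g q" for p q X Y
    unfolding nabla_def
    by (intro subspace_scale subspace_add subspace_diff subspace_g even_br scal_in that)
  show "scaled_metric g s k B y (nabla y X Y) Z
      + parity_sign p q * scaled_metric g s k B y Y (nabla y X Z) = 0"
    if "X \<in> g p" "Y \<in> g q" "Z \<in> g r" for p q r X Y Z
  proof -
    have skew: "B (br V Y) W = - (parity_sign p q * B Y (br V W))" if "V \<in> g p" for V W
      using super_skew[OF that \<open>Y \<in> g q\<close>] by (simp add: B_simps B_br)
    \<comment> \<open>Once all brackets with \<open>X\<close> are moved to the second argument, the
      compatibility condition is this identity; the two terms with
      \<open>scal y (br X (scal y Z))\<close> cancel.\<close>
    have "B Y (scal y (br X Z) - scal y (br (scal y X) Z)) =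
        B Y (br X (scal y Z) - br (scal y X) (scal y Z))"
      by (simp only: scal_br)
    then have *: "B Y (scal y (br X Z)) = B Y (scal y (br (scal y X) Z))
        + B Y (br X (scal y Z)) - B Y (br (scal y X) (scal y Z))"
      by (simp add: B_simps)
    have **: "B (br X (scal y Y)) (scal y Z) = - (parity_sign p q * B Y (scal y (br X (scal y Z))))"
      using super_skew[OF \<open>X \<in> g p\<close> scal_in[OF \<open>Y \<in> g q\<close>]] by (simp add: B_simps B_br B_scal)
    show ?thesis
      unfolding scaled_metric_eq B_scal
      unfolding nabla_def
      by (simp add: linear_add[OF linear_scal] linear_diff[OF linear_scal]
          linear_cmul[OF linear_scal] B_simps skew[OF that(1)] skew[OF scal_in[OF that(1)]] ** *
          algebra_simps)
  qed
  show "nabla y X Y - parity_sign p q *\<^sub>R nabla y Y X = br X Y" if "X \<in> g p" "Y \<in> g q" for p q X Y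
    using super_skew[OF that] super_skew[OF scal_in[OF that(1)] that(2)]
      super_skew[OF that(1) scal_in[OF that(2)]]
    by (simp add: nabla_def algebra_simps flip: scaleR_add_left)
qed

lemma levi_civita_scaled_metric:
  assumes "\<forall>i\<in>{0..s}. y i \<noteq> 0"
  shows "levi_civita g br (scaled_metric g s k B y) = nabla y"
  using levi_civita_eqI is_metric_scaled_metric[OF assms] is_levi_civita_nabla by blast

lemma nabla_even_even:
  assumes "X \<in> g 0" "Y \<in> g 0"
  shows "nabla y X Y = (1/2) *\<^sub>R br X Y"
proof -
  \<comment> \<open>Different \<open>k i\<close> commute, so only equal weights meet. The
    projections \<open>part g 0\<close> make both sides bilinear on the whole space, as the
    reduction to \<open>homogeneous\<close> requires.\<close>
  have "br (part g 0 X) (scal y (part g 0 Y)) = br (scal y (part g 0 X)) (part g 0 Y)"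
  proof -
    have bil: "bilinear (\<lambda>X Y. br (part g 0 X) (scal y (part g 0 Y)))"
      "bilinear (\<lambda>X Y. br (scal y (part g 0 X)) (part g 0 Y))"
      unfolding bilinear_def
      by (auto intro!: linearI simp: br_simps linear_add[OF linear_scal] linear_cmul[OF linear_scal]
        linear_add[OF linear_part] linear_cmul[OF linear_part] algebra_simps)
    show ?thesis
    proof (rule bilinear_eq_homogeneous[OF bil])
      fix X Y assume "X \<in> homogeneous" "Y \<in> homogeneous"
      then show "br (part g 0 X) (scal y (part g 0 Y)) = br (scal y (part g 0 X)) (part g 0 Y)"
      proof (elim homogeneousE)
        fix i j assume *: "i \<le> s" "X \<in> k i" "j \<le> s" "Y \<in> k j"
        then show ?thesis
          using br_k_other[of i j X Y]
          by (cases "i = j") (simp_all add: part_same[OF k_even] scal_k br_simps)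
      qed (simp_all add: part_other br_simps linear_0[OF linear_scal])
    qed
  qed
  then show ?thesis
    using assms by (simp add: nabla_def part_same)
qed

lemma nabla_even_odd: "X \<in> g 0 \<Longrightarrow> Y \<in> g 1 \<Longrightarrow> nabla y X Y = br X Y - (1/2) *\<^sub>R br (scal y X) Y"
  by (simp add: nabla_def scal_odd algebra_simps flip: scaleR_add_left)

lemma nabla_odd_even: "X \<in> g 1 \<Longrightarrow> Y \<in> g 0 \<Longrightarrow> nabla y X Y = (1/2) *\<^sub>R br X (scal y Y)"
  by (simp add: nabla_def scal_odd)

lemma nabla_odd_odd: "X \<in> g 1 \<Longrightarrow> Y \<in> g 1 \<Longrightarrow> nabla y X Y = (1/2) *\<^sub>R br X Y"
  by (simp add: nabla_def scal_odd)

section \<open>Traces in dual bases\<close>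

abbreviation "dual i \<equiv> dual_vector B (k i) (some_basis (k i))"
abbreviation "odd_dual \<equiv> dual_vector B (g 1) (some_basis (g 1))"

lemma dual_families_k:
  "i \<le> s \<Longrightarrow> dual_families B (k i) (some_basis (k i)) (\<lambda>u. u) (dual i)"
  using nondegenerate_k[of i]
  by (intro dual_families_dual_vector finite_dimensional subspace_k bilinear_B) auto

lemma dual_families_odd:
  "dual_families B (g 1) (some_basis (g 1)) (\<lambda>u. u) odd_dual"
  using nondegenerate_odd
  by (intro dual_families_dual_vector finite_dimensional subspace_g bilinear_B) auto

text \<open>Orthogonality allows the dual bases of the \<open>k i\<close> to be joined; the pairs
  remember in which ideal the dual vector is taken.\<close>

lemma dual_families_even:
  "dual_families B (g 0) (SIGMA i:{0..s}. some_basis (k i)) snd (\<lambda>(i, u). dual i u)"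
proof -
  have d: "finite (some_basis (k i))" "u \<in> some_basis (k i) \<Longrightarrow> u \<in> k i"
    "u \<in> some_basis (k i) \<Longrightarrow> dual i u \<in> k i"
    "v \<in> k i \<Longrightarrow> (\<Sum>u\<in>some_basis (k i). B v (dual i u) *\<^sub>R u) = v" if "i \<le> s" for i u v
    using dual_families_k[OF that] by (auto simp: dual_families_def)
  have "(\<Sum>(i, u)\<in>(SIGMA i:{0..s}. some_basis (k i)). B v (dual i u) *\<^sub>R u) = v"
    if "v \<in> g 0" for v
  proof -
    have "(\<Sum>(i, u)\<in>(SIGMA i:{0..s}. some_basis (k i)). B v (dual i u) *\<^sub>R u) =
        (\<Sum>i\<in>{0..s}. \<Sum>u\<in>some_basis (k i). B v (dual i u) *\<^sub>R u)"
      using d by (subst sum.Sigma) auto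
    also have "\<dots> = (\<Sum>i\<in>{0..s}. \<Sum>u\<in>some_basis (k i). B (proj i v) (dual i u) *\<^sub>R u)"
      using d by (intro sum.cong refl) (simp add: B_proj)
    also have "\<dots> = (\<Sum>i\<in>{0..s}. proj i v)"
      using d proj_in by (intro sum.cong refl) auto
    finally show ?thesis
      using that by (simp add: sum_proj part_same)
  qed
  then show ?thesis
    unfolding dual_families_def using d k_even by (auto simp: split_beta)
qed

lemma finite_basis_k: "i \<le> s \<Longrightarrow> finite (some_basis (k i))"
  by (intro finite_some_basis finite_dimensional subspace_k)

lemma basis_k: "i \<le> s \<Longrightarrow> u \<in> some_basis (k i) \<Longrightarrow> u \<in> k i"
  using some_basis_subset[OF subspace_k] by auto

lemma dual_k: "i \<le> s \<Longrightarrow> u \<in> some_basis (k i) \<Longrightarrow> dual i u \<in> k i"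
  using dual_families_k[of i] by (auto simp: dual_families_def)

lemma basis_odd: "u \<in> some_basis (g 1) \<Longrightarrow> u \<in> g 1"
  using some_basis_subset[OF subspace_g] by auto

lemma dual_odd: "u \<in> some_basis (g 1) \<Longrightarrow> odd_dual u \<in> g 1"
  using dual_families_odd by (auto simp: dual_families_def)

lemma trace_even:
  assumes "linear F"
  shows "trace_on (g 0) (\<lambda>Z. part g 0 (F Z)) =
    (\<Sum>i\<in>{0..s}. \<Sum>u\<in>some_basis (k i). B (F u) (dual i u))"
proof -
  have "linear (\<lambda>Z. part g 0 (F Z))"
    using linear_compose[OF assms linear_part] by (simp add: o_def)
  then have "trace_on (g 0) (\<lambda>Z. part g 0 (F Z)) =
      (\<Sum>a\<in>(SIGMA i:{0..s}. some_basis (k i)).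
        B (part g 0 (F (snd a))) ((\<lambda>(i, u). dual i u) a))"
    by (intro trace_on_dual_families[OF finite_dimensional subspace_g bilinear_B dual_families_even])
      (auto intro: part_in)
  also have "\<dots> = (\<Sum>(i, u)\<in>(SIGMA i:{0..s}. some_basis (k i)). B (F u) (dual i u))"
    by (intro sum.cong refl) (auto simp: B_part[OF k_even] dual_k)
  also have "\<dots> = (\<Sum>i\<in>{0..s}. \<Sum>u\<in>some_basis (k i). B (F u) (dual i u))"
    by (subst sum.Sigma) (auto simp: finite_basis_k)
  finally show ?thesis .
qed

lemma trace_odd:
  assumes "linear F"
  shows "trace_on (g 1) (\<lambda>Z. part g 1 (F Z)) = (\<Sum>u\<in>some_basis (g 1). B (F u) (odd_dual u))"
proof -
  have "linear (\<lambda>Z. part g 1 (F Z))"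
    using linear_compose[OF assms linear_part] by (simp add: o_def)
  then have "trace_on (g 1) (\<lambda>Z. part g 1 (F Z)) =
      (\<Sum>u\<in>some_basis (g 1). B (part g 1 (F u)) (odd_dual u))"
    by (intro trace_on_dual_families[OF finite_dimensional subspace_g bilinear_B dual_families_odd])
      (auto intro: part_in)
  also have "\<dots> = (\<Sum>u\<in>some_basis (g 1). B (F u) (odd_dual u))"
    by (intro sum.cong refl) (auto simp: B_part dual_odd)
  finally show ?thesis .
qed

lemma linear_br_br: "linear (\<lambda>Z. br X (br Y Z))"
  by (rule linearI) (simp_all add: br_simps)

lemma trace_odd_br:
  assumes "X \<in> g 0" "Y \<in> g 0"
  shows "trace_on (g 1) (\<lambda>Z. br X (br Y Z)) =
    (\<Sum>u\<in>some_basis (g 1). B (br X (br Y u)) (odd_dual u))"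
  using trace_odd[OF linear_br_br, of X Y] assms
    trace_on_cong[OF subspace_g, of 1 "\<lambda>Z. part g 1 (br X (br Y Z))" "\<lambda>Z. br X (br Y Z)"]
  by (simp add: part_same br_01)

lemma trace_odd_br_commute:
  assumes "X \<in> g 0" "Y \<in> g 0"
  shows "trace_on (g 1) (\<lambda>Z. br X (br Y Z)) = trace_on (g 1) (\<lambda>Z. br Y (br X Z))"
  using bilinear_br assms
  by (intro trace_on_commute finite_dimensional subspace_g) (auto simp: bilinear_def intro: br_01)

text \<open>For \<open>X = br U V\<close> in a perfect ideal, \<open>U\<close> commutes with
  \<open>Y\<close>. Hence the operator on \<open>g 1\<close> is the commutator of
  \<open>br U\<close> with the composite of \<open>br V\<close> and \<open>br Y\<close>, which has
  trace zero.\<close>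

lemma trace_odd_br_other:
  assumes "i \<le> s" "j \<le> s" "i \<noteq> j" "X \<in> k i" "Y \<in> k j"
  shows "trace_on (g 1) (\<lambda>Z. br X (br Y Z)) = 0"
proof -
  have *: "trace_on (g 1) (\<lambda>Z. br X (br Y Z)) = 0"
    if "1 \<le> i" "i \<le> s" "j \<le> s" "i \<noteq> j" "X \<in> k i" "Y \<in> k j" for i j X Y
  proof -
    have Y: "Y \<in> g 0"
      using that k_even by auto
    \<comment> \<open>The sum in dual bases is visibly linear in \<open>X\<close>, so it suffices to
      treat brackets, which span the ideal.\<close>
    define T where "T X = (\<Sum>u\<in>some_basis (g 1). B (br X (br Y u)) (odd_dual u))" for X
    have T: "trace_on (g 1) (\<lambda>Z. br X (br Y Z)) = T X" if "X \<in> g 0" for X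
      unfolding T_def using that Y by (rule trace_odd_br)
    have "X \<in> span {br U V |U V. U \<in> k i \<and> V \<in> k i}"
      using that k_perfect by simp
    moreover have "linear T"
      unfolding T_def
      by (rule linearI) (simp_all add: br_simps B_simps sum.distrib sum_distrib_left)
    ultimately have "T X = 0"
    proof (rule linear_eq_0_on_span[rotated 2])
      fix W assume "W \<in> {br U V |U V. U \<in> k i \<and> V \<in> k i}"
      then obtain U V where W: "W = br U V" "U \<in> k i" "V \<in> k i"
        by auto
      then have UV: "U \<in> g 0" "V \<in> g 0"
        using that k_even by auto
      have "br Y U = 0"
        using W that br_k_other[of j i Y U] by auto
      then have comm: "br U (br Y Z) = br Y (br U Z)" for Z
        using jacobi_even[OF Y, of U Z] by (simp add: br_simps)
      have "br W (br Y Z) = br U (br V (br Y Z)) - br V (br Y (br U Z))" for Z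
        using jacobi_even[OF UV(1), of V "br Y Z"] W(1) comm[of Z] by simp
      then have "trace_on (g 1) (\<lambda>Z. br W (br Y Z)) =
          trace_on (g 1) (\<lambda>Z. br U (br V (br Y Z)) - br V (br Y (br U Z)))"
        by simp
      also have "\<dots> = trace_on (g 1) (\<lambda>Z. br U (br V (br Y Z)))
          - trace_on (g 1) (\<lambda>Z. br V (br Y (br U Z)))"
        using UV Y by (intro trace_on_diff subspace_g br_01)
      also have "trace_on (g 1) (\<lambda>Z. br U (br V (br Y Z))) =
          trace_on (g 1) (\<lambda>Z. br V (br Y (br U Z)))"
        using UV Y bilinear_br
        by (intro trace_on_commute[of "g 1" "br U" "\<lambda>Z. br V (br Y Z)"] finite_dimensional subspace_g
            linear_br_br br_01) (auto simp: bilinear_def)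
      finally show "T W = 0"
        using T[of W] W UV br_00 by simp
    qed
    then show ?thesis
      using T[of X] that k_even by auto
  qed
  show ?thesis
  proof (cases "i = 0")
    case True
    then have "trace_on (g 1) (\<lambda>Z. br Y (br X Z)) = 0"
      using assms by (intro *[of j i]) auto
    then show ?thesis
      using trace_odd_br_commute[of X Y] assms k_even by auto
  next
    case False
    then show ?thesis
      using assms by (intro *[of i j]) auto
  qed
qed

text \<open>\<open>ad W\<close> lies in the symplectic Lie algebra of \<open>B\<close> on \<open>g 1\<close>: exchanging the two dual bases
  of \<open>g 1\<close> changes the sign of the trace.\<close>

lemma trace_odd_ad:
  assumes W: "W \<in> g 0"
  shows "(\<Sum>u\<in>some_basis (g 1). B (br W u) (odd_dual u)) = 0"
proof -
  let ?O = "some_basis (g 1)"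
  have lin: "linear (br W)"
    using bilinear_br by (simp add: bilinear_def)
  \<comment> \<open>The family dual to \<open>odd_dual\<close> is \<open>- u\<close> because
    \<open>B\<close> is skew on \<open>g 1\<close>.\<close>
  have d: "dual_families B (g 1) ?O odd_dual (\<lambda>u. - u)"
    unfolding dual_families_def
  proof (intro conjI ballI)
    show "finite ?O"
      by (intro finite_some_basis finite_dimensional subspace_g)
    show "- u \<in> g 1" if "u \<in> ?O" for u
      using basis_odd[OF that] by (rule subspace_neg[OF subspace_g])
    show "odd_dual u \<in> g 1" if "u \<in> ?O" for u
      using that by (rule dual_odd)
    fix v assume v: "v \<in> g 1"
    have "(\<Sum>u\<in>?O. B v (- u) *\<^sub>R odd_dual u) - v \<in> g 1"
      using v dual_odd by (intro subspace_diff subspace_sum subspace_scale subspace_g)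
    moreover have "B w ((\<Sum>u\<in>?O. B v (- u) *\<^sub>R odd_dual u) - v) = 0" if w: "w \<in> g 1" for w
    proof -
      have "B w (\<Sum>u\<in>?O. B v (- u) *\<^sub>R odd_dual u) = (\<Sum>u\<in>?O. B u v * B w (odd_dual u))"
        unfolding bilinear_sum_right[OF bilinear_B]
        using v B_skew_odd[OF v basis_odd] by (intro sum.cong) (auto simp: B_simps)
      then show ?thesis
        using dual_families_expand[OF bilinear_B dual_families_odd w, of v] by (simp add: B_simps)
    qed
    ultimately show "(\<Sum>u\<in>?O. B v (- u) *\<^sub>R odd_dual u) = v"
      using nondegenerate_odd by fastforce
  qed
  have "(\<Sum>u\<in>?O. B (br W u) (odd_dual u)) = trace_on (g 1) (br W)"
    using W by (intro trace_on_dual_families[symmetric] finite_dimensional subspace_g bilinear_B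
        dual_families_odd lin br_01)
  also have "\<dots> = (\<Sum>u\<in>?O. B (br W (odd_dual u)) (- u))"
    using W by (intro trace_on_dual_families finite_dimensional subspace_g bilinear_B d lin br_01)
  also have "\<dots> = (\<Sum>u\<in>?O. - B (br W u) (odd_dual u))"
  proof (rule sum.cong[OF refl])
    fix u assume u: "u \<in> ?O"
    have "B (br W (odd_dual u)) (- u) = B (odd_dual u) (br W u)"
      using skew_even[OF W, of "odd_dual u"] by (simp add: B_simps B_br)
    also have "\<dots> = - B (br W u) (odd_dual u)"
      using u W by (intro B_skew_odd br_01 dual_odd basis_odd)
    finally show "B (br W (odd_dual u)) (- u) = - B (br W u) (odd_dual u)" .
  qed
  finally show ?thesis
    by (simp add: sum_negf)
qed

lemma nabla_in:
  assumes "X \<in> g p" "Y \<in> g q"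
  shows "nabla y X Y \<in> g (p + q)"
  using assms is_levi_civita_nabla unfolding is_levi_civita_def by blast

section \<open>Casimir operators as contracted traces\<close>

lemma B_casimir:
  "B X (casimir br B (k i) Y) = (\<Sum>u\<in>some_basis (k i). B X (br u (br (dual i u) Y)))"
  by (simp add: casimir_def bilinear_sum_right[OF bilinear_B])

text \<open>\<open>B\<close> is symmetric on \<open>k i\<close>, so either member of a dual pair may
  act first.\<close>

lemma B_casimir_swap:
  assumes "i \<le> s"
  shows "B X (casimir br B (k i) Y) = (\<Sum>u\<in>some_basis (k i). B X (br (dual i u) (br u Y)))"
proof -
  have "bilinear (\<lambda>u v. B X (br u (br v Y)))"
    unfolding bilinear_def by (auto intro!: linearI simp: br_simps B_simps)
  then show ?thesis
    unfolding B_casimir using assms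
    by (intro dual_families_sum_swap[OF bilinear_B dual_families_k[OF assms]] B_sym_even k_even)
qed

lemma casimir_odd:
  assumes "i \<le> s" "Y \<in> g 1"
  shows "casimir br B (k i) Y \<in> g 1"
  unfolding casimir_def
  using assms by (intro subspace_sum subspace_g br_01 k_even[OF _ basis_k] k_even[OF _ dual_k]) auto

lemma trace_br_left:
  assumes i: "i \<le> s" and X: "X \<in> g 1" and Y: "Y \<in> g 1"
  shows "(\<Sum>u\<in>some_basis (k i). B (br (br u X) Y) (dual i u)) = B X (casimir br B (k i) Y)"
  unfolding B_casimir
proof (rule sum.cong[OF refl])
  fix u assume u: "u \<in> some_basis (k i)"
  have "u \<in> g 0" "dual i u \<in> g 0"
    using u i basis_k dual_k k_even by blast+
  then have "br u X = - br X u" "br (dual i u) Y = - br Y (dual i u)"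
    using skew_even by auto
  then show "B (br (br u X) Y) (dual i u) = B X (br u (br (dual i u) Y))"
    by (simp add: B_br B_simps br_simps)
qed

text \<open>Here one bracket with an even vector is reversed, which gives the minus sign and the
  opposite order of the dual pair; in \<open>trace_br_left\<close> two reversals cancel.\<close>

lemma trace_br_right:
  assumes i: "i \<le> s" and X: "X \<in> g 1" and Y: "Y \<in> g 1"
  shows "(\<Sum>u\<in>some_basis (k i). B (br X (br u Y)) (dual i u)) = - B X (casimir br B (k i) Y)"
  unfolding B_casimir_swap[OF i] sum_negf[symmetric]
proof (rule sum.cong[OF refl])
  fix u assume u: "u \<in> some_basis (k i)"
  have "dual i u \<in> g 0"
    using u i dual_k k_even by blast
  then have "br (dual i u) (br u Y) = - br (br u Y) (dual i u)"
    by (rule skew_even)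
  then show "B (br X (br u Y)) (dual i u) = - B X (br (dual i u) (br u Y))"
    by (simp add: B_br B_simps)
qed

lemma scal_expand:
  assumes "W \<in> g 0"
  shows "scal y W = (\<Sum>i\<in>{0..s}. y i *\<^sub>R (\<Sum>u\<in>some_basis (k i). B W (dual i u) *\<^sub>R u))"
proof -
  have "(\<Sum>u\<in>some_basis (k i). B W (dual i u) *\<^sub>R u) = proj i W" if i: "i \<in> {0..s}" for i
  proof -
    have "(\<Sum>u\<in>some_basis (k i). B W (dual i u) *\<^sub>R u) =
        (\<Sum>u\<in>some_basis (k i). B (proj i W) (dual i u) *\<^sub>R u)"
      using i by (intro sum.cong refl) (simp add: B_proj dual_k)
    then show ?thesis
      using dual_families_k[of i] i proj_in[of i W] by (simp add: dual_families_def)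
  qed
  then show ?thesis
    using assms by (simp add: scal_def part_other)
qed

text \<open>Expanding the even vector \<open>br a Y\<close> in the dual bases of the \<open>k i\<close> allows the dual bases of
  \<open>g 1\<close> to be contracted away.\<close>

lemma trace_odd_scal:
  assumes Y: "Y \<in> g 1" and F: "linear F" "\<And>u. u \<in> g 0 \<Longrightarrow> F u \<in> g 1"
  shows "(\<Sum>a\<in>some_basis (g 1). B (F (scal y (br a Y))) (odd_dual a)) =
    (\<Sum>i\<in>{0..s}. y i * (\<Sum>u\<in>some_basis (k i). B (F u) (br Y (dual i u))))"
proof -
  let ?O = "some_basis (g 1)"
  have "(\<Sum>a\<in>?O. B (F (scal y (br a Y))) (odd_dual a)) =
      (\<Sum>a\<in>?O. \<Sum>i\<in>{0..s}. \<Sum>u\<in>some_basis (k i).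
        y i * (B a (br Y (dual i u)) * B (F u) (odd_dual a)))"
  proof (rule sum.cong[OF refl])
    fix a assume "a \<in> ?O"
    then have "br a Y \<in> g 0"
      using Y by (simp add: br_11 basis_odd)
    then show "B (F (scal y (br a Y))) (odd_dual a) =
      (\<Sum>i\<in>{0..s}. \<Sum>u\<in>some_basis (k i). y i * (B a (br Y (dual i u)) * B (F u) (odd_dual a)))"
      by (simp add: scal_expand linear_sum[OF F(1)] linear_cmul[OF F(1)]
          bilinear_sum_left[OF bilinear_B] B_simps B_br sum_distrib_left)
  qed
  also have "\<dots> = (\<Sum>i\<in>{0..s}. \<Sum>u\<in>some_basis (k i). \<Sum>a\<in>?O.
      y i * (B a (br Y (dual i u)) * B (F u) (odd_dual a)))"
    by (subst sum.swap) (intro sum.cong refl sum.swap)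
  also have "\<dots> = (\<Sum>i\<in>{0..s}. \<Sum>u\<in>some_basis (k i). y i * B (F u) (br Y (dual i u)))"
  proof (intro sum.cong refl)
    fix i u assume "i \<in> {0..s}" "u \<in> some_basis (k i)"
    then have "F u \<in> g 1"
      by (intro F k_even[OF _ basis_k]) auto
    then show "(\<Sum>a\<in>?O. y i * (B a (br Y (dual i u)) * B (F u) (odd_dual a))) =
        y i * B (F u) (br Y (dual i u))"
      using dual_families_expand[OF bilinear_B dual_families_odd, of "F u" "br Y (dual i u)"]
      by (simp flip: sum_distrib_left)
  qed
  finally show ?thesis
    by (simp add: sum_distrib_left)
qed

text \<open>The value agrees with that of \<open>trace_odd_scal_left\<close>, so both orders of
  multiplication contribute to the same multiple of the Casimir operators.\<close>

lemma trace_odd_scal_right: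
  assumes X: "X \<in> g 1" and Y: "Y \<in> g 1"
  shows "(\<Sum>a\<in>some_basis (g 1). B (br X (scal y (br a Y))) (odd_dual a)) =
    - (\<Sum>i\<in>{0..s}. y i * B X (casimir br B (k i) Y))"
proof -
  have "B (br X u) (br Y (dual i u)) = - B X (br u (br (dual i u) Y))"
    if "i \<le> s" "u \<in> some_basis (k i)" for i u
    using skew_even[of "dual i u" Y] that by (simp add: k_even[OF _ dual_k] B_br B_simps br_simps)
  then show ?thesis
    using bilinear_br
    by (subst trace_odd_scal[OF Y, of "br X"])
      (simp_all add: bilinear_def br_10[OF X] B_casimir sum_negf)
qed

lemma trace_odd_scal_left:
  assumes X: "X \<in> g 1" and Y: "Y \<in> g 1"
  shows "(\<Sum>a\<in>some_basis (g 1). B (br (scal y (br a X)) Y) (odd_dual a)) =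
    - (\<Sum>i\<in>{0..s}. y i * B X (casimir br B (k i) Y))"
proof -
  have "B (br u Y) (br X (dual i u)) = - B X (br (dual i u) (br u Y))"
    if "i \<le> s" "u \<in> some_basis (k i)" for i u
  proof -
    \<comment> \<open>Both brackets are odd, so the exchange costs a sign.\<close>
    have "B (br u Y) (br X (dual i u)) = - B (br X (dual i u)) (br u Y)"
      using that X Y by (intro B_skew_odd br_01 br_10 k_even[OF _ dual_k] k_even[OF _ basis_k])
    then show ?thesis
      by (simp add: B_br)
  qed
  then show ?thesis
    using bilinear_br Y
    by (subst trace_odd_scal[OF X, of "\<lambda>Z. br Z Y"])
      (simp_all add: bilinear_def br_01 B_casimir_swap sum_negf)
qed

section \<open>Killing forms of the ideals as traces on the even part\<close>

lemma killing_eq: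
  assumes "i \<le> s" "X \<in> k i" "Y \<in> k i"
  shows "killing br (k i) X Y = (\<Sum>u\<in>some_basis (k i). B (br X (br Y u)) (dual i u))"
  unfolding killing_def using assms
  by (intro trace_on_dual_families finite_dimensional subspace_k bilinear_B dual_families_k
      linear_br_br br_k k_even[of i])

lemma killing_commute:
  assumes "i \<le> s" "X \<in> k i" "Y \<in> k i"
  shows "killing br (k i) X Y = killing br (k i) Y X"
  unfolding killing_def using assms bilinear_br
  by (intro trace_on_commute finite_dimensional subspace_k br_k k_even[of i])
    (auto simp: bilinear_def)

text \<open>\<open>br Y\<close> kills every \<open>k m\<close> except \<open>k j\<close>, which it
  maps into itself; \<open>br X\<close> kills that image unless \<open>i = j\<close>.\<close>

lemma even_trace_br_br:
  assumes i: "i \<le> s" "X \<in> k i" and j: "j \<le> s" "Y \<in> k j"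
  shows "(\<Sum>m\<in>{0..s}. \<Sum>u\<in>some_basis (k m). B (br X (br Y u)) (dual m u)) =
    (if i = j then killing br (k i) X Y else 0)"
proof -
  have "(\<Sum>u\<in>some_basis (k m). B (br X (br Y u)) (dual m u)) =
      (if m = i then if i = j then killing br (k i) X Y else 0 else 0)" if m: "m \<le> s" for m
  proof (cases "m = i \<and> i = j")
    case True
    then show ?thesis
      using assms killing_eq by simp
  next
    case False
    have "br X (br Y u) = 0" if u: "u \<in> some_basis (k m)" for u
    proof (cases "m = j")
      case True
      then have "br Y u \<in> k m"
        using br_k[OF m k_even[OF j] basis_k[OF m u]] by simp
      then show ?thesis
        using False True i m by (intro br_k_other[of i m]) auto
    next
      case False
      then show ?thesis
        using br_k_other[of j m Y u] basis_k[OF m u] j m by (simp add: br_simps)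
    qed
    then show ?thesis
      using False by (auto simp: B_simps)
  qed
  then have "(\<Sum>m\<in>{0..s}. \<Sum>u\<in>some_basis (k m). B (br X (br Y u)) (dual m u)) =
      (\<Sum>m\<in>{0..s}. if m = i then if i = j then killing br (k i) X Y else 0 else 0)"
    by (intro sum.cong) auto
  then show ?thesis
    using i by simp
qed

section \<open>The Ricci curvature\<close>

context
  fixes y :: "nat \<Rightarrow> real"
  assumes nonzero: "\<forall>i\<in>{0..s}. y i \<noteq> 0"
begin

abbreviation "curv \<equiv> curvature g br (scaled_metric g s k B y)"
abbreviation "ric \<equiv> ricci g br (scaled_metric g s k B y)"

lemma curv_eq:
  assumes "X \<in> g p" "Y \<in> g q"
  shows "curv X Y Z = nabla y X (nabla y Y Z)
    - parity_sign p q *\<^sub>R nabla y Y (nabla y X Z) - nabla y (br X Y) Z"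
  using curvature_homogeneous[OF assms] bilinear_nabla
  by (simp add: levi_civita_scaled_metric[OF nonzero])

lemma curv_in:
  assumes "X \<in> g p" "Y \<in> g q" "Z \<in> g r"
  shows "curv X Y Z \<in> g (p + (q + r))"
proof -
  have "nabla y X (nabla y Y Z) \<in> g (p + (q + r))"
    using assms by (intro nabla_in)
  moreover have "nabla y Y (nabla y X Z) \<in> g (p + (q + r))"
    using assms by (subst add.left_commute) (intro nabla_in)
  moreover have "nabla y (br X Y) Z \<in> g (p + (q + r))"
    using assms by (subst add.assoc[symmetric]) (intro nabla_in even_br)
  ultimately show ?thesis
    unfolding curv_eq[OF assms(1,2)] by (intro subspace_diff subspace_scale subspace_g)
qed

lemma linear_curv:
  "linear (\<lambda>X. curv X Y Z)" "linear (\<lambda>Y. curv X Y Z)" "linear (\<lambda>Z. curv X Y Z)"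
  using linear_curvature[of "scaled_metric g s k B y"] bilinear_nabla
  by (simp_all add: levi_civita_scaled_metric[OF nonzero])

lemma ric_eq:
  "ric X Y = (\<Sum>i\<in>{0..s}. \<Sum>u\<in>some_basis (k i). B (curv u X Y) (dual i u))
    - (\<Sum>a\<in>some_basis (g 1). B (curv a X Y) (odd_dual a))"
  unfolding ricci_def supertrace_def
  by (simp add: trace_even[OF linear_curv(1)] trace_odd[OF linear_curv(1)])

lemma bilinear_ric: "bilinear ric"
  unfolding bilinear_def
  by (auto intro!: linearI simp: ric_eq B_simps linear_add[OF linear_curv(2)]
      linear_add[OF linear_curv(3)] linear_cmul[OF linear_curv(2)] linear_cmul[OF linear_curv(3)]
      sum.distrib sum_distrib_left right_diff_distrib)

text \<open>For arguments of different parity the curvature operator exchanges \<open>g 0\<close>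
  and \<open>g 1\<close>, so its diagonal blocks vanish.\<close>

lemma ric_mixed:
  assumes "X \<in> g p" "Y \<in> g q" "p \<noteq> q"
  shows "ric X Y = 0"
proof -
  have pq: "p + q = 1"
    using assms(3) by (cases p; cases q) simp_all
  have "B (curv u X Y) (dual i u) = 0" if "i \<le> s" "u \<in> some_basis (k i)" for i u
    using curv_in[OF k_even[OF that(1) basis_k[OF that]] assms(1,2)] that
    unfolding pq by (intro B_10 k_even[OF _ dual_k]) (simp_all add: bit_add_simps)
  moreover have "B (curv a X Y) (odd_dual a) = 0" if "a \<in> some_basis (g 1)" for a
    using curv_in[OF basis_odd[OF that] assms(1,2)] that
    unfolding pq by (intro B_01 dual_odd) (simp_all add: bit_add_simps)
  ultimately show ?thesis
    by (simp add: ric_eq)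
qed

lemma ric_even:
  assumes i: "i \<le> s" "X \<in> k i" and j: "j \<le> s" "Y \<in> k j"
  shows "ric X Y = - (1/4) * (if i = j then killing br (k i) X Y else 0)
    + y i * y j / 4 * trace_on (g 1) (\<lambda>Z. br X (br Y Z))"
proof -
  have X: "X \<in> g 0" and Y: "Y \<in> g 0"
    using assms k_even by auto
  \<comment> \<open>On the even part the connection is half the bracket for all weights, so this is
    the curvature of a bi-invariant metric on a Lie algebra.\<close>
  have "curv u X Y = - (1/4) *\<^sub>R br Y (br X u)" if u: "u \<in> g 0" for u
  proof -
    have "br u (br X Y) = br (br u X) Y + br X (br u Y)"
      using u by (rule jacobi_even)
    moreover have "br (br u X) Y = br Y (br X u)"
      using skew_even[OF u, of X] skew_even[OF Y, of "br X u"] by (simp add: br_simps)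
    ultimately show ?thesis
      unfolding curv_eq[OF u X] using u X Y
      by (simp add: nabla_even_even br_00 nabla_simps br_simps algebra_simps
          flip: scaleR_add_left)
  qed
  then have "(\<Sum>m\<in>{0..s}. \<Sum>u\<in>some_basis (k m). B (curv u X Y) (dual m u)) =
      (\<Sum>m\<in>{0..s}. \<Sum>u\<in>some_basis (k m). - (1/4) * B (br Y (br X u)) (dual m u))"
    by (intro sum.cong refl) (simp add: B_simps k_even[OF _ basis_k])
  also have "\<dots> = - (1/4) * (\<Sum>m\<in>{0..s}. \<Sum>u\<in>some_basis (k m). B (br Y (br X u)) (dual m u))"
    by (simp only: sum_distrib_left)
  also have "\<dots> = - (1/4) * (if i = j then killing br (k i) X Y else 0)"
    using even_trace_br_br[OF j i] killing_commute[of i X Y] assms by auto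
  finally have even: "(\<Sum>m\<in>{0..s}. \<Sum>u\<in>some_basis (k m). B (curv u X Y) (dual m u)) =
      - (1/4) * (if i = j then killing br (k i) X Y else 0)" .
  have "curv a X Y = (y i / 4 - y j / 2) *\<^sub>R br Y (br X a)
      + (y j / 2 * (1 - y i / 2) - y i / 4) *\<^sub>R br X (br Y a)" if a: "a \<in> g 1" for a
  proof -
    have 1: "br a (br X Y) = br Y (br X a) - br X (br Y a)"
      using skew_even[OF br_00[OF X Y], of a] jacobi_even[OF X, of Y a] by (simp add: algebra_simps)
    have 2: "br a X = - br X a" "br a Y = - br Y a"
      using skew_even[OF X, of a] skew_even[OF Y, of a] by auto
    have "br Y (br X a) = - br (br X a) Y"
      using Y by (rule skew_even)
    then have 3: "br (br X a) Y = - br Y (br X a)"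
      by simp
    \<comment> \<open>For \<open>i \<noteq> j\<close> the bracket is zero, so the weight
      \<open>y i\<close> is correct in every case.\<close>
    have 4: "scal y X = y i *\<^sub>R X" "scal y Y = y j *\<^sub>R Y" "scal y (br X Y) = y i *\<^sub>R br X Y"
      using i j Y by (auto intro: scal_k br_k')
    show ?thesis
      unfolding curv_eq[OF a X] using a X Y
      by (simp add: nabla_even_even nabla_odd_even nabla_even_odd br_00 br_10 br_01 nabla_simps
          br_simps 1 2 3 4 algebra_simps)
  qed
  then have "(\<Sum>a\<in>some_basis (g 1). B (curv a X Y) (odd_dual a)) =
      (\<Sum>a\<in>some_basis (g 1). (y i / 4 - y j / 2) * B (br Y (br X a)) (odd_dual a)
      + (y j / 2 * (1 - y i / 2) - y i / 4) * B (br X (br Y a)) (odd_dual a))"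
    by (intro sum.cong refl) (simp add: B_simps basis_odd)
  \<comment> \<open>Both orders have the same trace, so the coefficients add: the terms linear in
    the weights cancel and leave \<open>- y i * y j / 4\<close>, whose sign the supertrace
    reverses.\<close>
  also have "\<dots> = (y i / 4 - y j / 2) * trace_on (g 1) (\<lambda>Z. br X (br Y Z))
      + (y j / 2 * (1 - y i / 2) - y i / 4) * trace_on (g 1) (\<lambda>Z. br X (br Y Z))"
    using trace_odd_br[OF X Y] trace_odd_br[OF Y X] trace_odd_br_commute[OF X Y]
    by (simp add: sum.distrib flip: sum_distrib_left)
  finally show ?thesis
    by (simp add: ric_eq even algebra_simps)
qed

lemma ric_odd:
  assumes X: "X \<in> g 1" and Y: "Y \<in> g 1"
  shows "ric X Y = B X (\<Sum>i\<in>{0..s}. (y i / 2 - 1) *\<^sub>R casimir br B (k i) Y)"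
proof -
  let ?C = "\<lambda>i. B X (casimir br B (k i) Y)"
  have XY: "br X Y \<in> g 0"
    using X Y by (rule br_11)
  have "curv u X Y = - (1/4) *\<^sub>R br (br u X) Y + (y i / 4 - 1/4) *\<^sub>R br X (br u Y)"
    if u: "i \<le> s" "u \<in> k i" for i u
  proof -
    have u0: "u \<in> g 0"
      using u k_even by auto
    show ?thesis
      unfolding curv_eq[OF u0 X] using u u0 X Y XY jacobi_even[OF u0, of X Y]
      by (simp add: nabla_even_even nabla_odd_even nabla_even_odd nabla_odd_odd br_01 scal_k
          nabla_simps br_simps algebra_simps flip: scaleR_add_left)
  qed
  then have "(\<Sum>i\<in>{0..s}. \<Sum>u\<in>some_basis (k i). B (curv u X Y) (dual i u)) =
      (\<Sum>i\<in>{0..s}. - (1/4) * (\<Sum>u\<in>some_basis (k i). B (br (br u X) Y) (dual i u))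
        + (y i / 4 - 1/4) * (\<Sum>u\<in>some_basis (k i). B (br X (br u Y)) (dual i u)))"
    unfolding sum_distrib_left sum.distrib[symmetric]
    by (intro sum.cong refl) (simp add: B_simps basis_k)
  \<comment> \<open>The left and right traces have opposite signs, so the two contributions without
    a weight cancel.\<close>
  also have "\<dots> = (\<Sum>i\<in>{0..s}. - (y i / 4) * ?C i)"
    using X Y by (intro sum.cong refl) (simp add: trace_br_left trace_br_right algebra_simps)
  finally have even: "(\<Sum>i\<in>{0..s}. \<Sum>u\<in>some_basis (k i). B (curv u X Y) (dual i u)) =
      (\<Sum>i\<in>{0..s}. - (y i / 4) * ?C i)" .
  \<comment> \<open>The identity is written as \<open>scal\<close> with weight 1 so that
    \<open>trace_odd_scal_left\<close> applies to the unscaled bracket too.\<close>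
  have "curv a X Y = (1/4) *\<^sub>R br a (scal y (br X Y)) + (1/4) *\<^sub>R br X (scal y (br a Y))
      - br (scal (\<lambda>_. 1) (br a X)) Y + (1/2) *\<^sub>R br (scal y (br a X)) Y" if a: "a \<in> g 1" for a
    unfolding curv_eq[OF a X] using a X Y
    by (simp add: nabla_odd_even nabla_even_odd nabla_odd_odd br_11 nabla_simps br_simps scal_one)
  then have "(\<Sum>a\<in>some_basis (g 1). B (curv a X Y) (odd_dual a)) =
      (\<Sum>a\<in>some_basis (g 1). - (1/4) * B (br (scal y (br X Y)) a) (odd_dual a)
      + (1/4) * B (br X (scal y (br a Y))) (odd_dual a)
      - B (br (scal (\<lambda>_. 1) (br a X)) Y) (odd_dual a)
      + (1/2) * B (br (scal y (br a X)) Y) (odd_dual a))"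
    using skew_even[OF scal_even[OF XY]]
    by (intro sum.cong refl) (simp add: B_simps basis_odd)
  also have "\<dots> = - (1/4) * (\<Sum>a\<in>some_basis (g 1). B (br (scal y (br X Y)) a) (odd_dual a))
      + (1/4) * (\<Sum>a\<in>some_basis (g 1). B (br X (scal y (br a Y))) (odd_dual a))
      - (\<Sum>a\<in>some_basis (g 1). B (br (scal (\<lambda>_. 1) (br a X)) Y) (odd_dual a))
      + (1/2) * (\<Sum>a\<in>some_basis (g 1). B (br (scal y (br a X)) Y) (odd_dual a))"
    unfolding sum_distrib_left sum.distrib sum_subtractf ..
  \<comment> \<open>The first sum is the trace of a symplectic operator and vanishes; the others
    give \<open>- 1/4\<close> and \<open>- 1/2\<close> with weights, and \<open>+ 1\<close> without.
    Subtracting this from the even block yields \<open>y i / 2 - 1\<close>.\<close>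
  also have "\<dots> = - (3/4) * (\<Sum>i\<in>{0..s}. y i * ?C i) + (\<Sum>i\<in>{0..s}. ?C i)"
    using X Y trace_odd_ad[OF scal_even[OF XY]]
    by (simp add: trace_odd_scal_right trace_odd_scal_left)
  finally have "ric X Y = (\<Sum>i\<in>{0..s}. - (y i / 4) * ?C i)
      - (- (3/4) * (\<Sum>i\<in>{0..s}. y i * ?C i) + (\<Sum>i\<in>{0..s}. ?C i))"
    by (simp only: ric_eq even)
  also have "\<dots> = (\<Sum>i\<in>{0..s}. (y i / 2 - 1) * ?C i)"
    unfolding sum_distrib_left sum_subtractf[symmetric] sum.distrib[symmetric]
    by (intro sum.cong refl) (simp add: algebra_simps)
  finally show ?thesis
    by (simp add: bilinear_sum_right[OF bilinear_B] B_simps)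
qed

lemma einstein_iff_homogeneous:
  "einstein_with g br (scaled_metric g s k B y) c \<longleftrightarrow>
    (\<forall>i\<le>s. \<forall>j\<le>s. \<forall>X\<in>k i. \<forall>Y\<in>k j. ric X Y = c * (y i * B X Y)) \<and>
    (\<forall>X\<in>g 1. \<forall>Y\<in>g 1. ric X Y = c * B X Y)"
  (is "_ \<longleftrightarrow> ?R")
proof
  assume "einstein_with g br (scaled_metric g s k B y) c"
  then show ?R
    by (auto simp: einstein_with_def scaled_metric_eq scal_k scal_odd B_simps)
next
  assume R: ?R
  have bil: "bilinear (\<lambda>X Y. c * B (scal y X) Y)"
    unfolding bilinear_def
    by (auto intro!: linearI simp: B_simps linear_add[OF linear_scal] linear_cmul[OF linear_scal]
        algebra_simps)
  have "ric X Y = c * B (scal y X) Y" for X Y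
  proof (rule bilinear_eq_homogeneous[OF bilinear_ric bil])
    fix X Y assume "X \<in> homogeneous" "Y \<in> homogeneous"
    then show "ric X Y = c * B (scal y X) Y"
    proof (elim homogeneousE)
      fix i j assume "i \<le> s" "X \<in> k i" "j \<le> s" "Y \<in> k j"
      then show ?thesis
        using R by (simp add: scal_k B_simps)
    next
      fix i assume *: "i \<le> s" "X \<in> k i" "Y \<in> g 1"
      then have "X \<in> g 0"
        using k_even by auto
      then show ?thesis
        using ric_mixed[of X 0 Y 1] * by (simp add: B_01 scal_even)
    next
      fix i assume *: "i \<le> s" "Y \<in> k i" "X \<in> g 1"
      then have "Y \<in> g 0"
        using k_even by auto
      then show ?thesis
        using ric_mixed[of X 1 Y 0] * by (simp add: B_10 scal_odd)
    next
      assume "X \<in> g 1" "Y \<in> g 1"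
      then show ?thesis
        using R by (simp add: scal_odd)
    qed
  qed
  then show "einstein_with g br (scaled_metric g s k B y) c"
    by (simp add: einstein_with_def scaled_metric_eq)
qed

end

section \<open>From Ricci values to the three equations\<close>

lemma killing_k0: "X \<in> k 0 \<Longrightarrow> Y \<in> k 0 \<Longrightarrow> killing br (k 0) X Y = 0"
  unfolding killing_def
  by (subst trace_on_cong[OF subspace_k, where G = "\<lambda>Z. 0"])
    (simp_all add: br_k0 br_simps trace_on_zero)

text \<open>\<open>k 0\<close> is abelian and commutes with the other ideals, so only the odd block,
  with its minus sign, contributes.\<close>

lemma super_killing_k0:
  assumes "X \<in> k 0" "Y \<in> k 0"
  shows "super_killing g br X Y = - trace_on (g 1) (\<lambda>Z. br X (br Y Z))"
proof -
  have 0: "X \<in> g 0" "Y \<in> g 0"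
    using assms k_even by auto
  have "trace_on (g 0) (\<lambda>Z. part g 0 (br X (br Y Z))) = 0"
    using even_trace_br_br[of 0 X 0 Y] assms by (simp add: trace_even linear_br_br killing_k0)
  then show ?thesis
    unfolding super_killing_def supertrace_def
    using trace_odd[OF linear_br_br, of X Y] trace_odd_br[OF 0] by simp
qed

lemma killing_nonzero:
  assumes i: "1 \<le> i" "i \<le> s"
    and b: "\<forall>X\<in>k i. \<forall>Y\<in>k i. B X Y = b * killing br (k i) X Y"
  obtains X Y where "X \<in> k i" "Y \<in> k i" "killing br (k i) X Y \<noteq> 0"
proof -
  have "is_simple br (k i)"
    using decomposition i by (auto simp: reductive_decomposition_def)
  then obtain U V where "U \<in> k i" "V \<in> k i" "br U V \<noteq> 0"
    by (auto simp: is_simple_def is_abelian_def)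
  \<comment> \<open>\<open>br_simps(9)\<close> says that \<open>br 0 V = 0\<close>, so the vector
    \<open>U\<close> obtained before is not zero.\<close>
  then obtain X where "X \<in> k i" "X \<noteq> 0"
    using br_simps(9) by metis
  then obtain Y where Y: "Y \<in> k i" "B Y X \<noteq> 0"
    using nondegenerate_k[OF i(2)] by blast
  then show thesis
    using b \<open>X \<in> k i\<close> that[of Y X] by auto
qed

end

theorem theorem3p9:
  fixes g :: "bit \<Rightarrow> 'a::real_vector set"
    and br :: "'a \<Rightarrow> 'a \<Rightarrow> 'a"
    and s :: nat
    and k :: "nat \<Rightarrow> 'a set"
    and B :: "'a \<Rightarrow> 'a \<Rightarrow> real"
    and b l x :: "nat \<Rightarrow> real"
    and c :: real
  assumes "lie_superalgebra g br"
    and "reductive_decomposition br (g 0) s k"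
    and "is_metric g B"
    and "bi_invariant br B"
    and "\<forall>i\<in>{1..s}. \<forall>X\<in>k i. \<forall>Y\<in>k i. B X Y = b i * killing br (k i) X Y"
    and "\<forall>i\<in>{0..s}. x i \<noteq> 0"
    and "\<forall>i\<in>{1..s}. is_index br (k i) (g 1) (l i)"
  shows "einstein_with g br (scaled_metric g s k B x) c \<longleftrightarrow>
     (\<forall>X\<in>k 0. \<forall>Y\<in>k 0. - (x 0 / 4) * super_killing g br X Y = c * B X Y) \<and>
     (\<forall>i\<in>{1..s}. 1 / 4 * (l i * (x i)\<^sup>2 - 1) = c * x i * b i) \<and>
     (\<forall>Z\<in>g 1. (\<Sum>i\<in>{0..s}. (x i / 2 - 1) *\<^sub>R casimir br B (k i) Z) = c *\<^sub>R Z)"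
proof -
  interpret reductive_superalgebra g br s k B
    using assms(1-4) by (simp add: reductive_superalgebra_def reductive_superalgebra_axioms_def)
  note x = assms(6)
  let ?ric = "ricci g br (scaled_metric g s k B x)"
  let ?C = "\<lambda>Z. \<Sum>i\<in>{0..s}. (x i / 2 - 1) *\<^sub>R casimir br B (k i) Z"
  have off: "?ric X Y = c * (x i * B X Y)"
    if "i \<le> s" "j \<le> s" "i \<noteq> j" "X \<in> k i" "Y \<in> k j" for i j X Y
    using that ric_even[OF x that(1,4,2,5)] trace_odd_br_other[OF that] B_k_other[OF that] by simp
  have k0: "?ric X Y = c * (x 0 * B X Y) \<longleftrightarrow> - (x 0 / 4) * super_killing g br X Y = c * B X Y"
    if "X \<in> k 0" "Y \<in> k 0" for X Y
  proof -
    \<comment> \<open>Both sides of the Einstein condition carry a factor \<open>x 0\<close>;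
      cancelling it leaves the first equation.\<close>
    have "?ric X Y = x 0 * (- (x 0 / 4) * super_killing g br X Y)"
      using ric_even[OF x, of 0 X 0 Y] that by (simp add: super_killing_k0 killing_k0)
    moreover have "x 0 \<noteq> 0"
      using x by simp
    ultimately show ?thesis
      by (metis mult.left_commute mult_left_cancel)
  qed
  have ki: "?ric X Y = c * (x i * B X Y) \<longleftrightarrow>
      (1 / 4 * (l i * (x i)\<^sup>2 - 1) - c * x i * b i) * killing br (k i) X Y = 0"
    if "1 \<le> i" "i \<le> s" "X \<in> k i" "Y \<in> k i" for i X Y
  proof -
    have "trace_on (g 1) (\<lambda>Z. br X (br Y Z)) = l i * killing br (k i) X Y"
      "B X Y = b i * killing br (k i) X Y"
      using assms(5,7) that by (auto simp: is_index_def)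
    \<comment> \<open>Everything on a simple ideal is a multiple of its Killing form, so one pair
      with a non-zero value decides the scalar equation.\<close>
    then have "?ric X Y - c * (x i * B X Y) =
        (1 / 4 * (l i * (x i)\<^sup>2 - 1) - c * x i * b i) * killing br (k i) X Y"
      using ric_even[OF x that(2,3,2,4)] by (simp add: algebra_simps power2_eq_square)
    then show ?thesis
      by (metis eq_iff_diff_eq_0)
  qed
  have simple: "(\<forall>X\<in>k i. \<forall>Y\<in>k i. ?ric X Y = c * (x i * B X Y)) \<longleftrightarrow>
      1 / 4 * (l i * (x i)\<^sup>2 - 1) = c * x i * b i" if i: "1 \<le> i" "i \<le> s" for i
  proof -
    obtain X Y where "X \<in> k i" "Y \<in> k i" "killing br (k i) X Y \<noteq> 0"
      using killing_nonzero[OF i] assms(5) i by (metis atLeastAtMost_iff)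
    then show ?thesis
      using ki[OF i] by auto
  qed
  have odd: "(\<forall>X\<in>g 1. \<forall>Y\<in>g 1. ?ric X Y = c * B X Y) \<longleftrightarrow> (\<forall>Z\<in>g 1. ?C Z = c *\<^sub>R Z)"
  proof -
    have "(\<forall>X\<in>g 1. ?ric X Z = c * B X Z) \<longleftrightarrow> ?C Z = c *\<^sub>R Z" if Z: "Z \<in> g 1" for Z
    proof -
      \<comment> \<open>The Ricci condition at \<open>Z\<close> says that \<open>W\<close> is
        orthogonal to \<open>g 1\<close>; the third equation at \<open>Z\<close> says that it is
        zero.\<close>
      define W where "W = ?C Z - c *\<^sub>R Z"
      have W: "W \<in> g 1"
        unfolding W_def using Z by (intro subspace_diff subspace_sum subspace_scale subspace_g casimir_odd) auto
      have "?ric X Z = c * B X Z \<longleftrightarrow> B X W = 0" if "X \<in> g 1" for X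
        using ric_odd[OF x that Z] by (simp add: W_def B_simps)
      then have "(\<forall>X\<in>g 1. ?ric X Z = c * B X Z) \<longleftrightarrow> (\<forall>X\<in>g 1. B X W = 0)"
        by simp
      also have "\<dots> \<longleftrightarrow> W = 0"
        using nondegenerate_odd[OF W] by (auto simp: B_simps)
      finally show ?thesis
        by (simp add: W_def)
    qed
    then show ?thesis by blast
  qed
  have "(\<forall>i\<le>s. \<forall>j\<le>s. \<forall>X\<in>k i. \<forall>Y\<in>k j. ?ric X Y = c * (x i * B X Y)) \<longleftrightarrow>
      (\<forall>X\<in>k 0. \<forall>Y\<in>k 0. ?ric X Y = c * (x 0 * B X Y)) \<and>
      (\<forall>i\<in>{1..s}. \<forall>X\<in>k i. \<forall>Y\<in>k i. ?ric X Y = c * (x i * B X Y))" (is "?L \<longleftrightarrow> ?R")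
  proof
    assume R: ?R
    show ?L
    proof (intro allI impI ballI)
      fix i j X Y assume *: "i \<le> s" "j \<le> s" "X \<in> k i" "Y \<in> k j"
      show "?ric X Y = c * (x i * B X Y)"
      proof (cases "i = j")
        case True
        then show ?thesis
          using R * by (cases "i = 0") auto
      next
        case False
        then show ?thesis
          using off * by blast
      qed
    qed
  qed auto
  then show ?thesis
    unfolding einstein_iff_homogeneous[OF x] odd using k0 simple by auto
qed

end
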